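(* Let $|\Psi^{RQ_1Q_2}\rangle$ be a pure state prepared by Alice, who keeps $R$, sends $Q_1$ to Bob through a noisy channel $\mathcal{E}_1$ and $Q_2$ to Charlie through a noisy channel $\mathcal{E}_2$, each realized by a unitary coupling to an environment $E_1$ (resp. $E_2$) initially in a pure state, with final state $\rho^{RQ_1'E_1'Q_2'E_2'}$. Let $P^{min}_{AB}=H_{Bob}-\chi^{E_1'}$ and $P^{min}_{AC}=H_{Charlie}-\chi^{E_2'}$ with $H_{Bob}\le\chi^{Q_1'}$, $H_{Charlie}\le\chi^{Q_2'}$, and let $\mathcal{P}_{A(BC)}$ be the optimal guaranteed privacy between Alice and the pair (Bob, Charlie) when Bob and Charlie may perform a joint measurement. Then $$P^{min}_{AB}+P^{min}_{AC}\le\mathcal{P}_{A(BC)}.$$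
   Context: Notation: $S$ is von Neumann entropy. Holevo quantities $\chi^{Q_1'},\chi^{E_1'}$ (resp. $\chi^{Q_2'},\chi^{E_2'}$) are those of Alice's classical encoding ensemble as received by Bob (resp. Charlie) and by the environment $E_1$ (resp. $E_2$), i.e. Eve; $H_{Bob}$, $H_{Charlie}$ are the classical information obtained by Bob and Charlie. Coherent informations: $I_c(A\rangle B)=S(\rho^{Q_1'})-S(\rho^{RQ_1'})$, $I_c(A\rangle C)=S(\rho^{Q_2'})-S(\rho^{RQ_2'})$, $I_c(A\rangle BC)=S(\rho^{Q_1'Q_2'})-S(\rho^{RQ_1'Q_2'})$, from marginals of the final state. Standing conventions of the framework: $\chi^{Q_1'}-\chi^{E_1'}=I_c(A\rangle B)$, $\chi^{Q_2'}-\chi^{E_2'}=I_c(A\rangle C)$. The optimal guaranteed privacy $\mathcal{P}_{A(BC)}=\sup P_G$ is the supremum over strategies of Alice and the receivers of the guaranteed privacy $P_G$ (infimum over Eve's strategies of $H_{Bob+Charlie}-H_{Eve}$, with Bob and Charlie measuring jointly), and it satisfies (Schumacher–Westmoreland bound) $\mathcal{P}_{A(BC)}\ge I_c(A\rangle BC)$. *)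

theory Defs
  imports Complex_Main "Jordan_Normal_Form.Char_Poly"
begin

text \<open>Eigenvalues (with multiplicity) of a square complex matrix: a list of the roots of its
  characteristic polynomial.  The sum below is invariant under permutation of the list, so the
  choice is irrelevant.\<close>

definition eigvals :: "complex mat \<Rightarrow> complex list" where
  "eigvals A = (SOME as. char_poly A = (\<Prod>a\<leftarrow>as. [:- a, 1:]) \<and> length as = dim_row A)"

text \<open>von Neumann entropy S(rho) = - sum_i lambda_i log2 lambda_i (0 log 0 = 0 automatically,
  since log 2 0 = 0 in Isabelle).\<close>

definition vn_entropy :: "complex mat \<Rightarrow> real" where
  "vn_entropy \<rho> = - (\<Sum>l\<leftarrow>eigvals \<rho>. Re l * log 2 (Re l))"

text \<open>Given an amplitude function amp (kept index, traced index) of a pure state, an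
  enumeration dec of the n basis vectors of the kept subsystem, and the finite set T of basis
  indices of the traced-out subsystems, the reduced density matrix is
  rho(i,j) = sum over t in T of amp(dec i, t) * conj(amp(dec j, t)).\<close>

definition reduced_dm :: "nat \<Rightarrow> (nat \<Rightarrow> 'i) \<Rightarrow> 't set \<Rightarrow> ('i \<Rightarrow> 't \<Rightarrow> complex) \<Rightarrow> complex mat" where
  "reduced_dm n dec T amp = mat n n (\<lambda>(i, j). \<Sum>t\<in>T. amp (dec i) t * cnj (amp (dec j) t))"

text \<open>Systems: R (dim dR), Q1 (dim d1), E1 (dim e1), Q2 (dim d2), E2 (dim e2).
  Psi r a b: amplitudes of the initial pure state on R Q1 Q2.
  phi1, phi2: initial pure states of the environments.
  U1 : unitary on Q1 E1, U2 : unitary on Q2 E2, as matrices indexed by pairs.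
  final_amp r a x b y: amplitudes of the final pure state on R Q1' E1' Q2' E2'.\<close>

definition unitary_on :: "'i set \<Rightarrow> ('i \<Rightarrow> 'i \<Rightarrow> complex) \<Rightarrow> bool" where
  "unitary_on I U \<longleftrightarrow>
     (\<forall>i\<in>I. \<forall>j\<in>I. (\<Sum>k\<in>I. cnj (U k i) * U k j) = (if i = j then 1 else 0))"

definition final_amp ::
  "nat \<Rightarrow> nat \<Rightarrow> nat \<Rightarrow> nat \<Rightarrow> (nat \<Rightarrow> nat \<Rightarrow> nat \<Rightarrow> complex) \<Rightarrow> (nat \<Rightarrow> complex) \<Rightarrow> (nat \<Rightarrow> complex)
   \<Rightarrow> (nat \<times> nat \<Rightarrow> nat \<times> nat \<Rightarrow> complex) \<Rightarrow> (nat \<times> nat \<Rightarrow> nat \<times> nat \<Rightarrow> complex)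
   \<Rightarrow> nat \<Rightarrow> nat \<Rightarrow> nat \<Rightarrow> nat \<Rightarrow> nat \<Rightarrow> complex" where
  "final_amp d1 e1 d2 e2 \<Psi> \<phi>1 \<phi>2 U1 U2 r a x b y =
     (\<Sum>a0<d1. \<Sum>x0<e1. \<Sum>b0<d2. \<Sum>y0<e2.
        U1 (a, x) (a0, x0) * U2 (b, y) (b0, y0) * \<Psi> r a0 b0 * \<phi>1 x0 * \<phi>2 y0)"

text \<open>Marginals of the final state (basis of a composite kept system enumerated in
  lexicographic order).\<close>

definition rho_Q1 where
  "rho_Q1 dR d1 e1 d2 e2 \<Psi> \<phi>1 \<phi>2 U1 U2 =
     reduced_dm d1 (\<lambda>k. k) ({..<dR} \<times> {..<e1} \<times> {..<d2} \<times> {..<e2})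
       (\<lambda>a (r, x, b, y). final_amp d1 e1 d2 e2 \<Psi> \<phi>1 \<phi>2 U1 U2 r a x b y)"

definition rho_Q2 where
  "rho_Q2 dR d1 e1 d2 e2 \<Psi> \<phi>1 \<phi>2 U1 U2 =
     reduced_dm d2 (\<lambda>k. k) ({..<dR} \<times> {..<d1} \<times> {..<e1} \<times> {..<e2})
       (\<lambda>b (r, a, x, y). final_amp d1 e1 d2 e2 \<Psi> \<phi>1 \<phi>2 U1 U2 r a x b y)"

definition rho_RQ1 where
  "rho_RQ1 dR d1 e1 d2 e2 \<Psi> \<phi>1 \<phi>2 U1 U2 =
     reduced_dm (dR * d1) (\<lambda>k. (k div d1, k mod d1)) ({..<e1} \<times> {..<d2} \<times> {..<e2})
       (\<lambda>(r, a) (x, b, y). final_amp d1 e1 d2 e2 \<Psi> \<phi>1 \<phi>2 U1 U2 r a x b y)"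

definition rho_RQ2 where
  "rho_RQ2 dR d1 e1 d2 e2 \<Psi> \<phi>1 \<phi>2 U1 U2 =
     reduced_dm (dR * d2) (\<lambda>k. (k div d2, k mod d2)) ({..<d1} \<times> {..<e1} \<times> {..<e2})
       (\<lambda>(r, b) (a, x, y). final_amp d1 e1 d2 e2 \<Psi> \<phi>1 \<phi>2 U1 U2 r a x b y)"

definition rho_Q1Q2 where
  "rho_Q1Q2 dR d1 e1 d2 e2 \<Psi> \<phi>1 \<phi>2 U1 U2 =
     reduced_dm (d1 * d2) (\<lambda>k. (k div d2, k mod d2)) ({..<dR} \<times> {..<e1} \<times> {..<e2})
       (\<lambda>(a, b) (r, x, y). final_amp d1 e1 d2 e2 \<Psi> \<phi>1 \<phi>2 U1 U2 r a x b y)"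

definition rho_RQ1Q2 where
  "rho_RQ1Q2 dR d1 e1 d2 e2 \<Psi> \<phi>1 \<phi>2 U1 U2 =
     reduced_dm (dR * d1 * d2) (\<lambda>k. (k div (d1 * d2), (k div d2) mod d1, k mod d2))
       ({..<e1} \<times> {..<e2})
       (\<lambda>(r, a, b) (x, y). final_amp d1 e1 d2 e2 \<Psi> \<phi>1 \<phi>2 U1 U2 r a x b y)"

definition Ic_B where
  "Ic_B dR d1 e1 d2 e2 \<Psi> \<phi>1 \<phi>2 U1 U2 =
     vn_entropy (rho_Q1 dR d1 e1 d2 e2 \<Psi> \<phi>1 \<phi>2 U1 U2)
     - vn_entropy (rho_RQ1 dR d1 e1 d2 e2 \<Psi> \<phi>1 \<phi>2 U1 U2)"

definition Ic_C where
  "Ic_C dR d1 e1 d2 e2 \<Psi> \<phi>1 \<phi>2 U1 U2 =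
     vn_entropy (rho_Q2 dR d1 e1 d2 e2 \<Psi> \<phi>1 \<phi>2 U1 U2)
     - vn_entropy (rho_RQ2 dR d1 e1 d2 e2 \<Psi> \<phi>1 \<phi>2 U1 U2)"

definition Ic_BC where
  "Ic_BC dR d1 e1 d2 e2 \<Psi> \<phi>1 \<phi>2 U1 U2 =
     vn_entropy (rho_Q1Q2 dR d1 e1 d2 e2 \<Psi> \<phi>1 \<phi>2 U1 U2)
     - vn_entropy (rho_RQ1Q2 dR d1 e1 d2 e2 \<Psi> \<phi>1 \<phi>2 U1 U2)"

end

theory Submission
  imports Defs "Jordan_Normal_Form.Schur_Decomposition"
begin

text \<open>
  By the hypotheses it suffices that coherent information is superadditive,
  \<open>I\<^sub>c(A\<rangle>B) + I\<^sub>c(A\<rangle>C) \<le> I\<^sub>c(A\<rangle>BC)\<close>. This holds for every pure state of \<open>R Q\<^sub>1 Q\<^sub>2 E\<close>, whatever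
  channels produced it. Strong subadditivity gives \<open>I\<^sub>c(A\<rangle>B) \<le> I\<^sub>c(A\<rangle>BC)\<close> and
  \<open>I\<^sub>c(A\<rangle>C) \<le> I\<^sub>c(A\<rangle>BC)\<close>. Applied to \<open>R Q\<^sub>1 E\<close>, together with the equality of the entropies of
  complementary marginals of a pure state, it also gives \<open>I\<^sub>c(A\<rangle>B) + I\<^sub>c(A\<rangle>C) \<le> 0\<close>. If
  \<open>I\<^sub>c(A\<rangle>BC) < 0\<close>, both summands are at most \<open>I\<^sub>c(A\<rangle>BC)\<close>; otherwise the last bound suffices.

  Strong subadditivity is the monotonicity of \<open>D(\<rho>\<^sub>A\<^sub>B\<^sub>C \<parallel> 1 \<otimes> \<rho>\<^sub>B\<^sub>C)\<close> under the partial trace over \<open>C\<close>.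
  With eigenpairs \<open>(p\<^sub>k, v\<^sub>k)\<close> of \<open>\<rho>\<close> and \<open>(q\<^sub>l, w\<^sub>l)\<close> of \<open>\<sigma>\<close> and traces put aside, \<open>D(\<rho> \<parallel> \<sigma>)\<close> is the integral over \<open>0 < s < 1\<close> of \<open>1 - s\<close> times
  \<open>\<Sum>k l. \<bar>\<langle>v\<^sub>k, w\<^sub>l\<rangle>\<bar>\<^sup>2 (p\<^sub>k - q\<^sub>l)\<^sup>2 / (q\<^sub>l + s (p\<^sub>k - q\<^sub>l))\<close>, and this sum is the maximum over all operators \<open>Y\<close>
  of \<open>2 Re tr (\<rho> - \<sigma>) Y - s tr Y\<^sup>* \<rho> Y - (1 - s) tr Y \<sigma> Y\<^sup>*\<close>. Testing with \<open>Y \<otimes> 1\<close> shows that it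
  cannot increase under a partial trace.
\<close>

section \<open>Spectral theorem for Hermitian matrices\<close>

lemma mat_adjoint_dim [simp]:
  "dim_row (mat_adjoint A) = dim_col A" "dim_col (mat_adjoint A) = dim_row A"
  unfolding mat_adjoint_def by auto

lemma mat_adjoint_carrier [simp]: "A \<in> carrier_mat n m \<Longrightarrow> mat_adjoint A \<in> carrier_mat m n"
  by (intro carrier_matI) auto

lemma mat_adjoint_index [simp]:
  "i < dim_col A \<Longrightarrow> j < dim_row A \<Longrightarrow> mat_adjoint A $$ (i, j) = conjugate (A $$ (j, i))"
  unfolding mat_adjoint_def by (simp add: mat_of_rows_index)

lemma mat_adjoint_mult:
  fixes A B :: "complex mat"
  assumes "A \<in> carrier_mat n m" "B \<in> carrier_mat m k"
  shows "mat_adjoint (A * B) = mat_adjoint B * mat_adjoint A"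
  using assms
  by (intro eq_matI) (auto simp: scalar_prod_def mult.commute intro!: sum.cong)

lemma mat_adjoint_adjoint [simp]: "mat_adjoint (mat_adjoint (A :: complex mat)) = A"
  by (intro eq_matI) auto

lemma mat_adjoint_zero [simp]: "mat_adjoint (0\<^sub>m n m :: complex mat) = 0\<^sub>m m n"
  by (intro eq_matI) auto

lemma mat_adjoint_one [simp]: "mat_adjoint (1\<^sub>m n :: complex mat) = 1\<^sub>m n"
  by (intro eq_matI) auto

lemma mat_adjoint_four_block:
  fixes A :: "complex mat"
  assumes "A \<in> carrier_mat n1 m1" "B \<in> carrier_mat n1 m2" "C \<in> carrier_mat n2 m1" "D \<in> carrier_mat n2 m2"
  shows "mat_adjoint (four_block_mat A B C D) =
    four_block_mat (mat_adjoint A) (mat_adjoint C) (mat_adjoint B) (mat_adjoint D)"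
  using assms by (intro eq_matI) auto

text \<open>Gram-Schmidt on a basis starting with \<open>v\<close> keeps \<open>v\<close> in front.
  Its output is orthogonal but not normalized, so each column is divided by its norm, and
  \<open>c\<close> is the inverse norm of \<open>v\<close>.\<close>

lemma unitary_first_column:
  fixes v :: "complex vec"
  assumes v: "v \<in> carrier_vec n" and v0: "v \<noteq> 0\<^sub>v n"
  obtains W :: "complex mat" and c where "W \<in> carrier_mat n n" "mat_adjoint W * W = 1\<^sub>m n"
    "col W 0 = c \<cdot>\<^sub>v v"
proof -
  interpret cof_vec_space n "TYPE(complex)" .
  define b where "b = basis_completion v"
  define ws where "ws = gram_schmidt n b"
  from basis_completion[OF v v0, folded b_def]
  have b: "distinct b" "\<not> lin_dep (set b)" "set b \<subseteq> carrier_vec n" "hd b = v" "length b = n"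
    by auto
  have n: "n > 0" using v v0 by (cases n) auto
  obtain vs where bv: "b = v # vs" using b n by (cases b) auto
  have ws: "set ws \<subseteq> carrier_vec n" "corthogonal ws" "length ws = n"
    using gram_schmidt_result[OF b(3,1,2), of ws] b(5) by (auto simp: ws_def)
  have hdws: "ws ! 0 = v"
    using gram_schmidt_hd[OF v, of vs] bv ws(3) n unfolding ws_def by (cases "gram_schmidt n b") auto
  have wsi: "ws ! i \<in> carrier_vec n" if "i < n" for i using ws that by auto
  define \<nu> where "\<nu> i = (\<Sum>k<n. (cmod (ws ! i $ k))\<^sup>2)" for i
  have sp: "ws ! i \<bullet>c ws ! j = (\<Sum>k<n. ws ! i $ k * cnj (ws ! j $ k))" if "i < n" "j < n" for i j
    using wsi[OF that(1)] wsi[OF that(2)] by (simp add: scalar_prod_def lessThan_atLeast0)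
  have spn: "(\<Sum>k<n. ws ! i $ k * cnj (ws ! i $ k)) = of_real (\<nu> i)" for i
    unfolding \<nu>_def by (simp only: of_real_sum complex_norm_square)
  \<comment> \<open>\<open>corthogonal\<close> gives only that the squared norm is nonzero; as a sum
    of squares it is then positive.\<close>
  have nu0: "\<nu> i > 0" if "i < n" for i
  proof -
    have "\<nu> i \<ge> 0" unfolding \<nu>_def by (intro sum_nonneg) auto
    moreover have "\<nu> i \<noteq> 0"
      using corthogonalD[OF ws(2), of i i] that ws(3) unfolding sp[OF that that] spn[of i] by simp
    ultimately show ?thesis by simp
  qed
  define W where "W = mat n n (\<lambda>(i, j). of_real (1 / sqrt (\<nu> j)) * ws ! j $ i)"
  have W: "W \<in> carrier_mat n n" unfolding W_def by auto
  have "mat_adjoint W * W = 1\<^sub>m n"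
  proof (rule eq_matI)
    fix i j assume "i < dim_row (1\<^sub>m n :: complex mat)" "j < dim_col (1\<^sub>m n :: complex mat)"
    then have ij: "i < n" "j < n" by auto
    have "(mat_adjoint W * W) $$ (i, j) = (\<Sum>k<n. cnj (W $$ (k, i)) * W $$ (k, j))"
      using W ij by (simp add: scalar_prod_def lessThan_atLeast0)
    also have "\<dots> = of_real (1 / sqrt (\<nu> i)) * of_real (1 / sqrt (\<nu> j)) *
        (\<Sum>k<n. ws ! j $ k * cnj (ws ! i $ k))"
      unfolding sum_distrib_left using ij by (intro sum.cong) (auto simp: W_def)
    also have "\<dots> = (if i = j then 1 else 0)"
    proof (cases "i = j")
      case True
      have "1 / sqrt (\<nu> j) * (1 / sqrt (\<nu> j)) * \<nu> j = 1"
        using nu0[OF ij(2)] by (simp add: divide_simps)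
      then have "complex_of_real (1 / sqrt (\<nu> j) * (1 / sqrt (\<nu> j)) * \<nu> j) = 1"
        by (simp only: of_real_1)
      then show ?thesis using True by (simp only: spn of_real_mult if_True simp_thms)
    next
      case False
      then show ?thesis
        using corthogonalD[OF ws(2), of j i] ij ws(3) unfolding sp[OF ij(2,1)] by simp
    qed
    finally show "(mat_adjoint W * W) $$ (i, j) = 1\<^sub>m n $$ (i, j)" using ij by simp
  qed (use W in auto)
  moreover have "col W 0 = of_real (1 / sqrt (\<nu> 0)) \<cdot>\<^sub>v v"
    using n v hdws by (intro eq_vecI) (auto simp: W_def)
  ultimately show thesis using that W by blast
qed

text \<open>Deflation: a unitary whose first column is an eigenvector splits off a one-dimensional
  block, and induction treats the rest. The entries \<open>d i\<close> are left complex; for density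
  matrices they are found real and nonnegative later.\<close>

theorem hermitian_diagonalization:
  fixes A :: "complex mat"
  assumes "A \<in> carrier_mat n n" "mat_adjoint A = A"
  shows "\<exists>U d. U \<in> carrier_mat n n \<and> mat_adjoint U * U = 1\<^sub>m n \<and>
    A = U * mat n n (\<lambda>(i, j). if i = j then d i else 0) * mat_adjoint U"
  using assms
proof (induction n arbitrary: A)
  case 0
  have "mat_adjoint (1\<^sub>m 0 :: complex mat) * 1\<^sub>m 0 = 1\<^sub>m 0" by simp
  moreover have "A = 1\<^sub>m 0 * mat 0 0 (\<lambda>(i, j). if i = j then 0 else 0) * mat_adjoint (1\<^sub>m 0)"
    using 0(1) by (intro eq_matI) auto
  ultimately show ?case by (intro exI[of _ "1\<^sub>m 0"] exI[of _ "\<lambda>_. 0"] conjI one_carrier_mat)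
next
  case (Suc n A)
  note A = Suc.prems(1) and herm = Suc.prems(2)
  \<comment> \<open>The characteristic polynomial splits over the complex numbers and has positive
    degree, so an eigenvalue exists.\<close>
  obtain as where as: "char_poly A = (\<Prod>a\<leftarrow>as. [:- a, 1:])" "length as = Suc n"
    using char_poly_factorized[OF A] by blast
  then obtain e es where es: "as = e # es" by (cases as) auto
  have "poly (char_poly A) e = 0" unfolding as(1) es by simp
  then have "eigenvalue A e" using eigenvalue_root_char_poly[OF A] by simp
  then obtain v where v: "v \<in> carrier_vec (Suc n)" "v \<noteq> 0\<^sub>v (Suc n)" "A *\<^sub>v v = e \<cdot>\<^sub>v v"
    using A unfolding eigenvalue_def eigenvector_def by auto
  obtain W c where W: "W \<in> carrier_mat (Suc n) (Suc n)" and WW: "mat_adjoint W * W = 1\<^sub>m (Suc n)"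
    and W0: "col W 0 = c \<cdot>\<^sub>v v"
    using unitary_first_column[OF v(1,2)] by blast
  have W'[simp]: "mat_adjoint W \<in> carrier_mat (Suc n) (Suc n)" using W by simp
  have WW': "W * mat_adjoint W = 1\<^sub>m (Suc n)"
    using mat_mult_left_right_inverse[OF W' W WW] .
  define A' where "A' = mat_adjoint W * A * W"
  have A': "A' \<in> carrier_mat (Suc n) (Suc n)" unfolding A'_def using W A by auto
  have AW: "A * W \<in> carrier_mat (Suc n) (Suc n)" using A W by auto
  have A'_eq: "A' = mat_adjoint W * (A * W)" unfolding A'_def by (rule assoc_mult_mat[OF W' A W])
  have herm': "mat_adjoint A' = A'"
  proof -
    have "mat_adjoint A' = mat_adjoint (A * W) * W"
      unfolding A'_eq by (subst mat_adjoint_mult[OF W' AW]) simp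
    also have "\<dots> = mat_adjoint W * A * W" by (subst mat_adjoint_mult[OF A W]) (simp add: herm)
    finally show ?thesis by (simp add: A'_def)
  qed
  \<comment> \<open>The first column of \<open>W\<close> is an eigenvector, and the adjoint of
    \<open>W\<close> sends it to the first unit vector.\<close>
  have "col A' 0 = mat_adjoint W *\<^sub>v (A *\<^sub>v col W 0)"
    unfolding A'_eq by (simp only: col_mult2[OF W' AW] col_mult2[OF A W] zero_less_Suc)
  also have "A *\<^sub>v col W 0 = e \<cdot>\<^sub>v col W 0"
    unfolding W0 mult_mat_vec[OF A v(1)] v(3) smult_smult_assoc by (simp only: mult.commute)
  also have "mat_adjoint W *\<^sub>v (e \<cdot>\<^sub>v col W 0) = e \<cdot>\<^sub>v (mat_adjoint W *\<^sub>v col W 0)"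
    by (rule mult_mat_vec[OF W']) (use v(1) in \<open>auto simp: W0\<close>)
  also have "mat_adjoint W *\<^sub>v col W 0 = col (mat_adjoint W * W) 0"
    using col_mult2[OF W' W, of 0] by simp
  finally have "col A' 0 = e \<cdot>\<^sub>v unit_vec (Suc n) 0" by (simp add: WW)
  then have "col A' 0 $ i = (e \<cdot>\<^sub>v unit_vec (Suc n) 0) $ i" for i by simp
  moreover have "col A' 0 $ i = A' $$ (i, 0)" "(e \<cdot>\<^sub>v unit_vec (Suc n) 0) $ i = (if i = 0 then e else 0)"
    if "i < Suc n" for i
    using that A' by auto
  ultimately have A'0: "A' $$ (i, 0) = (if i = 0 then e else 0)" if "i < Suc n" for i
    using that by simp
  have hermi: "A' $$ (i, j) = cnj (A' $$ (j, i))" if "i < Suc n" "j < Suc n" for i j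
    using arg_cong[OF herm', of "\<lambda>M. M $$ (i, j)"] that A' by simp
  define A3 where "A3 = mat n n (\<lambda>(i, j). A' $$ (Suc i, Suc j))"
  have A3: "A3 \<in> carrier_mat n n" by (simp add: A3_def)
  have "mat_adjoint A3 = A3"
    by (intro eq_matI) (auto simp: A3_def intro!: hermi[symmetric])
  then obtain U d where U: "U \<in> carrier_mat n n" "mat_adjoint U * U = 1\<^sub>m n"
    and A3U: "A3 = U * mat n n (\<lambda>(i, j). if i = j then d i else 0) * mat_adjoint U"
    using Suc.IH[OF A3] by blast
  define V where "V = four_block_mat (1\<^sub>m 1) (0\<^sub>m 1 n) (0\<^sub>m n 1) U"
  let ?D = "\<lambda>n d. mat n n (\<lambda>(i, j). if i = j then d i else (0 :: complex))"
  have V: "V \<in> carrier_mat (Suc n) (Suc n)"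
    unfolding V_def using four_block_carrier_mat[of "1\<^sub>m 1" 1 1 U n n] U by auto
  have V': "mat_adjoint V = four_block_mat (1\<^sub>m 1) (0\<^sub>m 1 n) (0\<^sub>m n 1) (mat_adjoint U)"
    unfolding V_def using U
    by (subst mat_adjoint_four_block) auto
  have VV: "mat_adjoint V * V = 1\<^sub>m (Suc n)"
    unfolding V' unfolding V_def using U by (subst mult_four_block_mat) auto
  define d' where "d' i = (case i of 0 \<Rightarrow> e | Suc i \<Rightarrow> d i)" for i
  have D: "?D (Suc n) d' = four_block_mat (e \<cdot>\<^sub>m 1\<^sub>m 1) (0\<^sub>m 1 n) (0\<^sub>m n 1) (?D n d)"
    by (intro eq_matI) (auto simp: d'_def split: nat.splits)
  have "V * ?D (Suc n) d' * mat_adjoint V = four_block_mat (e \<cdot>\<^sub>m 1\<^sub>m 1) (0\<^sub>m 1 n) (0\<^sub>m n 1) A3"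
    unfolding V' unfolding D V_def A3U using U
    by (subst mult_four_block_mat, auto)+
  also have "\<dots> = A'"
  proof (rule eq_matI)
    fix i j assume ij: "i < dim_row A'" "j < dim_col A'"
    \<comment> \<open>Hermiticity turns the known first column into the first row, and the corner
      entry shows that \<open>e\<close> is real.\<close>
    have "A' $$ (0, j) = cnj (A' $$ (j, 0))" by (rule hermi) (use ij A' in auto)
    moreover have "cnj e = e" by (metis hermi A'0 zero_less_Suc)
    ultimately show "four_block_mat (e \<cdot>\<^sub>m 1\<^sub>m 1) (0\<^sub>m 1 n) (0\<^sub>m n 1) A3 $$ (i, j) = A' $$ (i, j)"
      using ij A' A'0 by (auto simp: A3_def)
  qed (use A' in \<open>auto simp: A3_def\<close>)
  finally have VDV: "A' = V * ?D (Suc n) d' * mat_adjoint V" by simp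
  have V'c: "mat_adjoint V \<in> carrier_mat (Suc n) (Suc n)" using V by simp
  have Dc: "?D (Suc n) d' \<in> carrier_mat (Suc n) (Suc n)" by simp
  have WV: "W * V \<in> carrier_mat (Suc n) (Suc n)" using W V by auto
  have adjWV: "mat_adjoint (W * V) = mat_adjoint V * mat_adjoint W"
    by (rule mat_adjoint_mult[OF W V])
  have "mat_adjoint (W * V) * (W * V) = mat_adjoint V * (mat_adjoint W * W) * V"
    unfolding adjWV using W V V'c W'
    by (simp add: assoc_mult_mat[of _ "Suc n" "Suc n" _ "Suc n" _ "Suc n"] mult_carrier_mat[of _ "Suc n" "Suc n" _ "Suc n"])
  then have 1: "mat_adjoint (W * V) * (W * V) = 1\<^sub>m (Suc n)" using V V'c by (simp add: WW VV)
  have "W * A' * mat_adjoint W = (W * mat_adjoint W) * A * (W * mat_adjoint W)"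
    unfolding A'_def using W W' A
    by (simp add: assoc_mult_mat[of _ "Suc n" "Suc n" _ "Suc n" _ "Suc n"] mult_carrier_mat[of _ "Suc n" "Suc n" _ "Suc n"])
  then have "A = W * A' * mat_adjoint W" using A by (simp add: WW')
  also have "\<dots> = (W * V) * ?D (Suc n) d' * mat_adjoint (W * V)"
    unfolding adjWV VDV using W V W' V'c Dc
    by (simp add: assoc_mult_mat[of _ "Suc n" "Suc n" _ "Suc n" _ "Suc n"] mult_carrier_mat[of _ "Suc n" "Suc n" _ "Suc n"])
  finally show ?case using WV 1 by (intro exI[of _ "W * V"] exI[of _ d'] conjI)
qed

section \<open>Spectral decompositions of kernels\<close>

definition ip :: "'i set \<Rightarrow> ('i \<Rightarrow> complex) \<Rightarrow> ('i \<Rightarrow> complex) \<Rightarrow> complex" where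
  "ip I x y = (\<Sum>i\<in>I. cnj (x i) * y i)"

definition form :: "'i set \<Rightarrow> ('i \<Rightarrow> 'i \<Rightarrow> complex) \<Rightarrow> ('i \<Rightarrow> complex) \<Rightarrow> ('i \<Rightarrow> complex) \<Rightarrow> complex" where
  "form I \<rho> x y = (\<Sum>i\<in>I. \<Sum>j\<in>I. cnj (x i) * \<rho> i j * y j)"

definition orthonormal :: "'i set \<Rightarrow> 'k set \<Rightarrow> ('k \<Rightarrow> 'i \<Rightarrow> complex) \<Rightarrow> bool" where
  "orthonormal I K v \<longleftrightarrow> (\<forall>k\<in>K. \<forall>l\<in>K. ip I (v k) (v l) = of_bool (k = l))"

definition complete_basis :: "'i set \<Rightarrow> 'k set \<Rightarrow> ('k \<Rightarrow> 'i \<Rightarrow> complex) \<Rightarrow> bool" where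
  "complete_basis I K v \<longleftrightarrow>
     (\<forall>i\<in>I. \<forall>j\<in>I. (\<Sum>k\<in>K. v k i * cnj (v k j)) = of_bool (i = j))"

text \<open>Completeness is kept apart, and the index set \<open>K\<close> is free: a decomposition
  may omit kernel vectors, as the one in \<open>spectral_complement\<close> does.\<close>

definition spectral ::
  "'i set \<Rightarrow> ('i \<Rightarrow> 'i \<Rightarrow> complex) \<Rightarrow> 'k set \<Rightarrow> ('k \<Rightarrow> 'i \<Rightarrow> complex) \<Rightarrow> ('k \<Rightarrow> real) \<Rightarrow> bool" where
  "spectral I \<rho> K v p \<longleftrightarrow> orthonormal I K v \<and> (\<forall>k\<in>K. 0 \<le> p k) \<and>
     (\<forall>i\<in>I. \<forall>j\<in>I. \<rho> i j = (\<Sum>k\<in>K. of_real (p k) * v k i * cnj (v k j)))"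

text \<open>The kernel behind \<open>reduced_dm\<close> without an enumeration, so that composite
  systems can be indexed by product sets.\<close>

definition dm :: "'t set \<Rightarrow> ('i \<Rightarrow> 't \<Rightarrow> complex) \<Rightarrow> 'i \<Rightarrow> 'i \<Rightarrow> complex" where
  "dm T amp i j = (\<Sum>t\<in>T. amp i t * cnj (amp j t))"

lemma cnj_ip: "cnj (ip I x y) = ip I y x"
  by (simp add: ip_def mult.commute)

lemma ip_cmod: "ip I x y * ip I y x = of_real ((cmod (ip I x y))\<^sup>2)"
  using complex_norm_square[of "ip I x y"] by (simp only: cnj_ip)

lemma orthonormalD: "orthonormal I K v \<Longrightarrow> k \<in> K \<Longrightarrow> l \<in> K \<Longrightarrow> ip I (v k) (v l) = of_bool (k = l)"
  by (simp add: orthonormal_def)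

lemma sum_of_bool_eq:
  "finite I \<Longrightarrow> i \<in> I \<Longrightarrow> (\<Sum>j\<in>I. f j * of_bool (i = j)) = (f i :: complex)"
  "finite I \<Longrightarrow> i \<in> I \<Longrightarrow> (\<Sum>j\<in>I. f j * of_bool (j = i)) = f i"
  "finite I \<Longrightarrow> i \<in> I \<Longrightarrow> (\<Sum>j\<in>I. of_bool (i = j) * f j) = f i"
  "finite I \<Longrightarrow> i \<in> I \<Longrightarrow> (\<Sum>j\<in>I. of_bool (j = i) * f j) = f i"
  by (simp_all add: of_bool_def if_distrib if_distribR sum.delta sum.delta' cong: if_cong)

lemma spectral_ip: "spectral I \<rho> K v p \<Longrightarrow> k \<in> K \<Longrightarrow> l \<in> K \<Longrightarrow> ip I (v k) (v l) = of_bool (k = l)"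
  by (simp add: spectral_def orthonormal_def)

text \<open>The left and right vectors may differ, so this serves density kernels, the resolution of
  the identity and the operator built in \<open>variational_attained\<close>.\<close>

lemma form_expand:
  assumes "\<And>i j. i \<in> I \<Longrightarrow> j \<in> I \<Longrightarrow> \<rho> i j = (\<Sum>k\<in>K. c k * v k i * cnj (w k j))"
  shows "form I \<rho> x y = (\<Sum>k\<in>K. c k * ip I x (v k) * ip I (w k) y)"
proof -
  have "form I \<rho> x y = (\<Sum>i\<in>I. \<Sum>j\<in>I. \<Sum>k\<in>K. c k * (cnj (x i) * v k i) * (cnj (w k j) * y j))"
    unfolding form_def
    by (intro sum.cong refl) (simp add: assms sum_distrib_left sum_distrib_right mult_ac)
  also have "\<dots> = (\<Sum>i\<in>I. \<Sum>k\<in>K. \<Sum>j\<in>I. c k * (cnj (x i) * v k i) * (cnj (w k j) * y j))"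
    by (intro sum.cong refl sum.swap)
  also have "\<dots> = (\<Sum>k\<in>K. \<Sum>i\<in>I. \<Sum>j\<in>I. c k * (cnj (x i) * v k i) * (cnj (w k j) * y j))"
    by (rule sum.swap)
  also have "\<dots> = (\<Sum>k\<in>K. c k * ip I x (v k) * ip I (w k) y)"
    unfolding ip_def by (simp add: sum_distrib_left sum_distrib_right mult_ac)
  finally show ?thesis .
qed

lemma form_spectral:
  assumes "spectral I \<rho> K v p"
  shows "form I \<rho> x y = (\<Sum>k\<in>K. of_real (p k) * ip I x (v k) * ip I (v k) y)"
  using assms by (intro form_expand) (simp add: spectral_def)

lemma form_delta: "finite I \<Longrightarrow> form I (\<lambda>i j. of_bool (i = j)) x y = ip I x y"
  unfolding form_def ip_def
  by (intro sum.cong refl) (simp add: mult.assoc sum_distrib_left[symmetric] sum_of_bool_eq)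

text \<open>Completeness is a rank-one expansion of the identity kernel with all coefficients equal
  to 1.\<close>

lemma parseval:
  assumes "finite I" "complete_basis I K v"
  shows "ip I x y = (\<Sum>k\<in>K. ip I x (v k) * ip I (v k) y)"
proof -
  have "form I (\<lambda>i j. of_bool (i = j)) x y = (\<Sum>k\<in>K. 1 * ip I x (v k) * ip I (v k) y)"
    by (rule form_expand) (use assms(2) in \<open>simp add: complete_basis_def\<close>)
  then show ?thesis using assms(1) by (simp add: form_delta)
qed

section \<open>Eigenvector equations and spectral sums\<close>

lemma form_eigen_left:
  assumes "finite K" "spectral I \<rho> K v p" "k \<in> K"
  shows "form I \<rho> (v k) y = of_real (p k) * ip I (v k) y"
proof -
  have "form I \<rho> (v k) y = (\<Sum>l\<in>K. of_bool (k = l) * (of_real (p l) * ip I (v l) y))"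
    unfolding form_spectral[OF assms(2)]
    by (intro sum.cong refl) (simp add: spectral_ip[OF assms(2)] assms(3))
  then show ?thesis using assms by (simp only: sum_of_bool_eq)
qed

lemma form_eigen_right:
  assumes "finite K" "spectral I \<rho> K v p" "k \<in> K"
  shows "form I \<rho> x (v k) = of_real (p k) * ip I x (v k)"
proof -
  have "form I \<rho> x (v k) = (\<Sum>l\<in>K. of_bool (l = k) * (of_real (p l) * ip I x (v l)))"
    unfolding form_spectral[OF assms(2)]
    by (intro sum.cong refl) (simp add: spectral_ip[OF assms(2)] assms(3))
  then show ?thesis using assms by (simp only: sum_of_bool_eq)
qed

text \<open>Evaluating the form at \<open>v k\<close>, \<open>w l\<close> from either side shows
  that eigenvectors with different eigenvalues are orthogonal, so \<open>f (q l)\<close> may be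
  replaced by \<open>f (p k)\<close>. The overlaps of \<open>v k\<close> may sum to less than 1 when
  \<open>w\<close> omits kernel vectors, but only if \<open>p k = 0\<close>, where
  \<open>f 0 = 0\<close> helps.\<close>

lemma spectral_sum_overlap:
  assumes fin: "finite K" "finite L" and v: "spectral I \<rho> K v p" and w: "spectral I \<rho> L w q"
    and f0: "f 0 = (0 :: real)"
  shows "(\<Sum>k\<in>K. f (p k)) = (\<Sum>k\<in>K. \<Sum>l\<in>L. (cmod (ip I (v k) (w l)))\<^sup>2 * f (q l))"
proof (rule sum.cong[OF refl])
  fix k assume k: "k \<in> K"
  let ?m = "\<lambda>l. (cmod (ip I (v k) (w l)))\<^sup>2"
  have eq: "?m l = 0 \<or> q l = p k" if l: "l \<in> L" for l
  proof -
    have "of_real (p k) * ip I (v k) (w l) = of_real (q l) * ip I (v k) (w l)"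
      using form_eigen_left[OF fin(1) v k, of "w l"] form_eigen_right[OF fin(2) w l, of "v k"] by metis
    then show ?thesis by auto
  qed
  \<comment> \<open>Computing the diagonal value at \<open>v k\<close> in both decompositions shows
    that the overlaps sum to 1 unless \<open>p k = 0\<close>.\<close>
  have "of_real (p k) = (form I \<rho> (v k) (v k) :: complex)"
    using form_eigen_left[OF fin(1) v k, of "v k"] k by (simp add: spectral_ip[OF v])
  also have "\<dots> = (\<Sum>l\<in>L. of_real (q l) * (ip I (v k) (w l) * ip I (w l) (v k)))"
    unfolding form_spectral[OF w] by (simp add: mult.assoc)
  also have "\<dots> = of_real (\<Sum>l\<in>L. q l * ?m l)"
    by (simp add: ip_cmod)
  finally have "p k = (\<Sum>l\<in>L. q l * ?m l)" using of_real_eq_iff by blast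
  also have "\<dots> = (\<Sum>l\<in>L. p k * ?m l)"
  proof (rule sum.cong[OF refl])
    fix l assume "l \<in> L"
    then show "q l * ?m l = p k * ?m l" using eq[of l] by auto
  qed
  finally have pk: "p k = p k * (\<Sum>l\<in>L. ?m l)" by (simp add: sum_distrib_left)
  have "(\<Sum>l\<in>L. ?m l * f (q l)) = (\<Sum>l\<in>L. ?m l * f (p k))"
  proof (rule sum.cong[OF refl])
    fix l assume "l \<in> L"
    then show "?m l * f (q l) = ?m l * f (p k)" using eq[of l] by auto
  qed
  also have "\<dots> = (\<Sum>l\<in>L. ?m l) * f (p k)" by (simp add: sum_distrib_right)
  also have "\<dots> = f (p k)" using pk f0 by (cases "p k = 0") auto
  finally show "f (p k) = (\<Sum>l\<in>L. ?m l * f (q l))" by simp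
qed

text \<open>Both sums expand over the same overlaps, and \<open>f (p k) = f (q l)\<close> wherever
  the overlap is nonzero. This makes the entropy independent of the decomposition and of its index
  set.\<close>

lemma spectral_sum_unique:
  assumes fin: "finite K" "finite L" and v: "spectral I \<rho> K v p" and w: "spectral I \<rho> L w q"
    and f0: "f 0 = (0 :: real)"
  shows "(\<Sum>k\<in>K. f (p k)) = (\<Sum>l\<in>L. f (q l))"
proof -
  have sym: "cmod (ip I x y) = cmod (ip I y x)" for x y
    by (metis cnj_ip complex_mod_cnj)
  have "(\<Sum>k\<in>K. f (p k)) = (\<Sum>k\<in>K. \<Sum>l\<in>L. (cmod (ip I (v k) (w l)))\<^sup>2 * f (q l))"
    by (rule spectral_sum_overlap[OF fin v w]) (rule f0)
  also have "\<dots> = (\<Sum>l\<in>L. \<Sum>k\<in>K. (cmod (ip I (v k) (w l)))\<^sup>2 * f (q l))" by (rule sum.swap)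
  also have "\<dots> = (\<Sum>l\<in>L. \<Sum>k\<in>K. (cmod (ip I (w l) (v k)))\<^sup>2 * f (p k))"
  proof (intro sum.cong refl)
    fix l k assume l: "l \<in> L" and k: "k \<in> K"
    have "of_real (p k) * ip I (v k) (w l) = of_real (q l) * ip I (v k) (w l)"
      using form_eigen_left[OF fin(1) v k, of "w l"] form_eigen_right[OF fin(2) w l, of "v k"] by metis
    then have "ip I (v k) (w l) = 0 \<or> p k = q l" by auto
    then show "(cmod (ip I (v k) (w l)))\<^sup>2 * f (q l) = (cmod (ip I (w l) (v k)))\<^sup>2 * f (p k)"
      using sym[of "v k" "w l"] by auto
  qed
  also have "\<dots> = (\<Sum>l\<in>L. f (q l))"
    by (rule spectral_sum_overlap[OF fin(2,1) w v, symmetric]) (rule f0)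
  finally show ?thesis .
qed

text \<open>This is the Schmidt decomposition: the partial inner products of \<open>amp\<close> with the
  eigenvectors of one marginal are orthogonal eigenvectors of the complementary one.\<close>

lemma spectral_complement:
  assumes fin: "finite I" "finite T" "finite K" and v: "spectral I (dm T amp) K v p"
    and c: "complete_basis I K v"
  shows "spectral T (dm I (\<lambda>t i. amp i t)) {k \<in> K. p k > 0}
    (\<lambda>k t. ip I (v k) (\<lambda>i. amp i t) / of_real (sqrt (p k))) p"
proof -
  define x where "x k t = ip I (v k) (\<lambda>i. amp i t)" for k t
  \<comment> \<open>The Gram matrix of the partial inner products is the form of the first marginal
    on its own eigenvectors, hence diagonal.\<close>
  have xx: "ip T (x k) (x l) = of_real (p k) * of_bool (k = l)" if "k \<in> K" "l \<in> K" for k l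
  proof -
    have "ip T (x k) (x l) = (\<Sum>t\<in>T. (\<Sum>i\<in>I. cnj (v l i) * amp i t) * (\<Sum>j\<in>I. v k j * cnj (amp j t)))"
      by (simp add: ip_def x_def mult.commute)
    also have "\<dots> = (\<Sum>t\<in>T. \<Sum>i\<in>I. \<Sum>j\<in>I. cnj (v l i) * (amp i t * cnj (amp j t)) * v k j)"
      by (simp add: sum_product mult_ac)
    also have "\<dots> = (\<Sum>i\<in>I. \<Sum>t\<in>T. \<Sum>j\<in>I. cnj (v l i) * (amp i t * cnj (amp j t)) * v k j)"
      by (rule sum.swap)
    also have "\<dots> = (\<Sum>i\<in>I. \<Sum>j\<in>I. \<Sum>t\<in>T. cnj (v l i) * (amp i t * cnj (amp j t)) * v k j)"
      by (intro sum.cong refl sum.swap)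
    also have "\<dots> = form I (dm T amp) (v l) (v k)"
      unfolding form_def dm_def by (simp add: sum_distrib_left sum_distrib_right)
    also have "\<dots> = of_real (p k) * of_bool (k = l)"
      using form_eigen_right[OF fin(3) v that(1), of "v l"] that by (auto simp: spectral_ip[OF v])
    finally show ?thesis .
  qed
  \<comment> \<open>A vanishing eigenvalue forces a vanishing vector, so dropping these indices
    loses nothing and no division by zero remains.\<close>
  have x0: "x k t = 0" if "k \<in> K" "\<not> p k > 0" "t \<in> T" for k t
  proof -
    have "p k = 0" using that v unfolding spectral_def by force
    then have "ip T (x k) (x k) = 0" using xx[of k k] that by simp
    then have "complex_of_real (\<Sum>t\<in>T. (cmod (x k t))\<^sup>2) = 0"
      unfolding ip_def of_real_sum complex_norm_square by (simp add: mult.commute)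
    then have "(\<Sum>t\<in>T. (cmod (x k t))\<^sup>2) = 0" using of_real_eq_0_iff by blast
    then show ?thesis using that fin by (simp add: sum_nonneg_eq_0_iff)
  qed
  have sq: "of_real (sqrt (p k)) * of_real (sqrt (p k)) = (of_real (p k) :: complex)" if "k \<in> K" for k
    using that v by (simp add: spectral_def flip: of_real_mult)
  have orth: "orthonormal T {k \<in> K. p k > 0} (\<lambda>k t. x k t / of_real (sqrt (p k)))"
    unfolding orthonormal_def
  proof (intro ballI)
    fix k l assume k: "k \<in> {k \<in> K. p k > 0}" and l: "l \<in> {k \<in> K. p k > 0}"
    have "ip T (\<lambda>t. x k t / of_real (sqrt (p k))) (\<lambda>t. x l t / of_real (sqrt (p l))) =
        ip T (x k) (x l) / (of_real (sqrt (p k)) * of_real (sqrt (p l)))"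
      unfolding ip_def by (simp add: sum_divide_distrib)
    also have "\<dots> = of_bool (k = l)" using xx[of k l] k l sq[of k] by auto
    finally show "ip T (\<lambda>t. x k t / of_real (sqrt (p k))) (\<lambda>t. x l t / of_real (sqrt (p l))) = of_bool (k = l)" .
  qed
  have "dm I (\<lambda>t i. amp i t) t u =
      (\<Sum>k\<in>{k \<in> K. p k > 0}. of_real (p k) * (x k t / of_real (sqrt (p k))) * cnj (x k u / of_real (sqrt (p k))))"
    if t: "t \<in> T" and u: "u \<in> T" for t u
  proof -
    have "dm I (\<lambda>t i. amp i t) t u = ip I (\<lambda>i. amp i u) (\<lambda>i. amp i t)"
      by (simp add: dm_def ip_def mult.commute)
    also have "\<dots> = (\<Sum>k\<in>K. ip I (\<lambda>i. amp i u) (v k) * ip I (v k) (\<lambda>i. amp i t))"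
      by (rule parseval[OF fin(1) c])
    also have "\<dots> = (\<Sum>k\<in>K. x k t * cnj (x k u))"
      by (simp add: x_def cnj_ip mult.commute)
    also have "\<dots> = (\<Sum>k\<in>{k \<in> K. p k > 0}. x k t * cnj (x k u))"
      by (rule sum.mono_neutral_right) (use fin x0 t in auto)
    also have "\<dots> = (\<Sum>k\<in>{k \<in> K. p k > 0}. of_real (p k) * (x k t / of_real (sqrt (p k))) * cnj (x k u / of_real (sqrt (p k))))"
      by (rule sum.cong) (auto simp: sq[symmetric])
    finally show ?thesis .
  qed
  then have "spectral T (dm I (\<lambda>t i. amp i t)) {k \<in> K. p k > 0} (\<lambda>k t. x k t / of_real (sqrt (p k))) p"
    using orth by (auto simp: spectral_def)
  then show ?thesis by (simp add: x_def)
qed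

section \<open>A variational formula\<close>

definition tr :: "'i set \<Rightarrow> ('i \<Rightarrow> 'i \<Rightarrow> complex) \<Rightarrow> ('i \<Rightarrow> 'i \<Rightarrow> complex) \<Rightarrow> complex" where
  "tr I \<rho> Y = (\<Sum>i\<in>I. \<Sum>j\<in>I. \<rho> i j * Y j i)"

text \<open>The trace of \<open>Y\<^sup>* \<rho> Y\<close>, summed over the columns of
  \<open>Y\<close>.\<close>

definition left_energy :: "'i set \<Rightarrow> ('i \<Rightarrow> 'i \<Rightarrow> complex) \<Rightarrow> ('i \<Rightarrow> 'i \<Rightarrow> complex) \<Rightarrow> complex" where
  "left_energy I \<rho> Y = (\<Sum>m\<in>I. form I \<rho> (\<lambda>i. Y i m) (\<lambda>i. Y i m))"

text \<open>The trace of \<open>Y \<sigma> Y\<^sup>*\<close>, summed over the rows of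
  \<open>Y\<close>.\<close>

definition right_energy :: "'i set \<Rightarrow> ('i \<Rightarrow> 'i \<Rightarrow> complex) \<Rightarrow> ('i \<Rightarrow> 'i \<Rightarrow> complex) \<Rightarrow> complex" where
  "right_energy I \<sigma> Y = (\<Sum>m\<in>I. form I \<sigma> (\<lambda>i. cnj (Y m i)) (\<lambda>i. cnj (Y m i)))"

definition variational where
  "variational I \<rho> \<sigma> s Y =
     2 * Re (tr I \<rho> Y - tr I \<sigma> Y) - s * Re (left_energy I \<rho> Y) - (1 - s) * Re (right_energy I \<sigma> Y)"

text \<open>For nonnegative eigenvalues and s strictly between 0 and 1, a denominator vanishes only
  if both eigenvalues do; the quotient is then 0 by the convention for division.\<close>

definition resolvent_sum where
  "resolvent_sum I K v p L w q s =
     (\<Sum>k\<in>K. \<Sum>l\<in>L. (cmod (ip I (v k) (w l)))\<^sup>2 * ((p k - q l)\<^sup>2 / (q l + s * (p k - q l))))"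

lemma ip_self: "ip I (\<lambda>m. x m) (\<lambda>m. x m) = (\<Sum>m\<in>I. x m * cnj (x m))"
  by (simp add: ip_def mult.commute)

lemma tr_spectral:
  assumes "spectral I \<rho> K v p"
  shows "tr I \<rho> Y = (\<Sum>k\<in>K. of_real (p k) * form I Y (v k) (v k))"
proof -
  have "tr I \<rho> Y = (\<Sum>i\<in>I. \<Sum>j\<in>I. \<Sum>k\<in>K. of_real (p k) * (cnj (v k j) * Y j i * v k i))"
    unfolding tr_def using assms
    by (intro sum.cong refl) (simp add: spectral_def sum_distrib_left sum_distrib_right mult_ac)
  also have "\<dots> = (\<Sum>i\<in>I. \<Sum>k\<in>K. \<Sum>j\<in>I. of_real (p k) * (cnj (v k j) * Y j i * v k i))"
    by (intro sum.cong refl sum.swap)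
  also have "\<dots> = (\<Sum>k\<in>K. \<Sum>i\<in>I. \<Sum>j\<in>I. of_real (p k) * (cnj (v k j) * Y j i * v k i))"
    by (rule sum.swap)
  also have "\<dots> = (\<Sum>k\<in>K. \<Sum>j\<in>I. \<Sum>i\<in>I. of_real (p k) * (cnj (v k j) * Y j i * v k i))"
    by (intro sum.cong refl sum.swap)
  finally show ?thesis unfolding form_def by (simp add: sum_distrib_left)
qed

text \<open>Here the adjoint of \<open>Y\<close> acts on the left vector, in
  \<open>form_right\<close> \<open>Y\<close> acts on the right one; \<open>parseval\<close> can then
  insert either basis.\<close>

lemma form_left: "form I Y x y = ip I (\<lambda>m. ip I (\<lambda>i. Y i m) x) y"
  unfolding form_def ip_def
  by (subst sum.swap) (simp add: sum_distrib_left sum_distrib_right mult_ac)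

lemma form_right: "form I Y x y = ip I x (\<lambda>m. ip I (\<lambda>i. cnj (Y m i)) y)"
  unfolding form_def ip_def by (simp add: sum_distrib_left mult_ac)

text \<open>The energy is the sum of \<open>p k\<close> times the squared norm of
  \<open>Y\<^sup>*\<close> applied to \<open>v k\<close>, and that norm is expanded in the basis
  \<open>w\<close>.\<close>

lemma left_energy_spectral:
  assumes "finite I" "spectral I \<rho> K v p" "complete_basis I L w"
  shows "left_energy I \<rho> Y = (\<Sum>k\<in>K. \<Sum>l\<in>L. of_real (p k * (cmod (form I Y (v k) (w l)))\<^sup>2))"
proof -
  have "left_energy I \<rho> Y = (\<Sum>m\<in>I. \<Sum>k\<in>K. of_real (p k) * (ip I (\<lambda>i. Y i m) (v k) * ip I (v k) (\<lambda>i. Y i m)))"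
    unfolding left_energy_def form_spectral[OF assms(2)] by (simp add: mult.assoc)
  also have "\<dots> = (\<Sum>k\<in>K. of_real (p k) *
      ip I (\<lambda>m. ip I (\<lambda>i. Y i m) (v k)) (\<lambda>m. ip I (\<lambda>i. Y i m) (v k)))"
    by (subst sum.swap) (simp only: ip_self sum_distrib_left cnj_ip)
  also have "\<dots> = (\<Sum>k\<in>K. of_real (p k) * (\<Sum>l\<in>L. of_real ((cmod (form I Y (v k) (w l)))\<^sup>2)))"
    by (subst parseval[OF assms(1,3)]) (simp only: ip_cmod form_left)
  finally show ?thesis by (simp add: sum_distrib_left)
qed

text \<open>Dually, the squared norm of \<open>Y\<close> applied to \<open>w l\<close> is weighted
  by \<open>q l\<close> and expanded in the basis \<open>v\<close>.\<close>

lemma right_energy_spectral: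
  assumes "finite I" "spectral I \<sigma> L w q" "complete_basis I K v"
  shows "right_energy I \<sigma> Y = (\<Sum>l\<in>L. \<Sum>k\<in>K. of_real (q l * (cmod (form I Y (v k) (w l)))\<^sup>2))"
proof -
  have "right_energy I \<sigma> Y = (\<Sum>m\<in>I. \<Sum>l\<in>L. of_real (q l) *
      (ip I (\<lambda>i. cnj (Y m i)) (w l) * ip I (w l) (\<lambda>i. cnj (Y m i))))"
    unfolding right_energy_def form_spectral[OF assms(2)] by (simp add: mult.assoc)
  also have "\<dots> = (\<Sum>l\<in>L. of_real (q l) *
      ip I (\<lambda>m. ip I (\<lambda>i. cnj (Y m i)) (w l)) (\<lambda>m. ip I (\<lambda>i. cnj (Y m i)) (w l)))"
    by (subst sum.swap) (simp only: ip_self sum_distrib_left cnj_ip)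
  also have "\<dots> = (\<Sum>l\<in>L. of_real (q l) * (\<Sum>k\<in>K. of_real ((cmod (form I Y (v k) (w l)))\<^sup>2)))"
  proof -
    have "ip I (\<lambda>m. ip I (\<lambda>i. cnj (Y m i)) (w l)) (\<lambda>m. ip I (\<lambda>i. cnj (Y m i)) (w l)) =
        (\<Sum>k\<in>K. of_real ((cmod (form I Y (v k) (w l)))\<^sup>2))" for l
      unfolding form_right ip_cmod[symmetric]
      by (subst parseval[OF assms(1,3)]) (simp only: mult.commute)
    then show ?thesis by simp
  qed
  finally show ?thesis by (simp add: sum_distrib_left)
qed

text \<open>In the mixed matrix entries of \<open>Y\<close> between the two eigenbases the
  functional decouples into one scalar quadratic per pair, which can be maximized
  separately.\<close>

lemma variational_spectral:
  assumes fin: "finite I"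
    and v: "spectral I \<rho> K v p" "complete_basis I K v"
    and w: "spectral I \<sigma> L w q" "complete_basis I L w"
  shows "variational I \<rho> \<sigma> s Y = (\<Sum>k\<in>K. \<Sum>l\<in>L.
    2 * (p k - q l) * Re (form I Y (v k) (w l) * cnj (ip I (v k) (w l)))
    - (q l + s * (p k - q l)) * (cmod (form I Y (v k) (w l)))\<^sup>2)"
proof -
  let ?y = "\<lambda>k l. form I Y (v k) (w l)" and ?c = "\<lambda>k l. ip I (v k) (w l)"
  have "tr I \<rho> Y = (\<Sum>k\<in>K. of_real (p k) * (\<Sum>l\<in>L. ?y k l * cnj (?c k l)))"
    unfolding tr_spectral[OF v(1)] cnj_ip form_left by (simp only: parseval[OF fin w(2), symmetric])
  then have 1: "Re (tr I \<rho> Y) = (\<Sum>k\<in>K. \<Sum>l\<in>L. p k * Re (?y k l * cnj (?c k l)))"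
    by (simp add: sum_distrib_left Re_sum del: complex_cnj_mult)
  have "form I Y (w l) (w l) = (\<Sum>k\<in>K. cnj (?c k l) * ?y k l)" for l
    unfolding cnj_ip form_right by (rule parseval[OF fin v(2)])
  then have "tr I \<sigma> Y = (\<Sum>l\<in>L. of_real (q l) * (\<Sum>k\<in>K. ?y k l * cnj (?c k l)))"
    unfolding tr_spectral[OF w(1)] by (simp add: mult.commute)
  then have "Re (tr I \<sigma> Y) = (\<Sum>l\<in>L. \<Sum>k\<in>K. q l * Re (?y k l * cnj (?c k l)))"
    by (simp add: sum_distrib_left Re_sum)
  then have 2: "Re (tr I \<sigma> Y) = (\<Sum>k\<in>K. \<Sum>l\<in>L. q l * Re (?y k l * cnj (?c k l)))"
    by (subst sum.swap)
  have 3: "Re (left_energy I \<rho> Y) = (\<Sum>k\<in>K. \<Sum>l\<in>L. p k * (cmod (?y k l))\<^sup>2)"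
    unfolding left_energy_spectral[OF fin v(1) w(2)] by (simp only: Re_sum Re_complex_of_real)
  have "Re (right_energy I \<sigma> Y) = (\<Sum>l\<in>L. \<Sum>k\<in>K. q l * (cmod (?y k l))\<^sup>2)"
    unfolding right_energy_spectral[OF fin w(1) v(2)] by (simp only: Re_sum Re_complex_of_real)
  then have 4: "Re (right_energy I \<sigma> Y) = (\<Sum>k\<in>K. \<Sum>l\<in>L. q l * (cmod (?y k l))\<^sup>2)"
    by (subst sum.swap)
  have "variational I \<rho> \<sigma> s Y = (\<Sum>k\<in>K. \<Sum>l\<in>L. 2 * (p k * Re (?y k l * cnj (?c k l))) -
      2 * (q l * Re (?y k l * cnj (?c k l))) - s * (p k * (cmod (?y k l))\<^sup>2) -
      (1 - s) * (q l * (cmod (?y k l))\<^sup>2))"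
    unfolding variational_def minus_complex.sel 1 2 3 4 right_diff_distrib sum_distrib_left sum_subtractf ..
  also have "\<dots> = (\<Sum>k\<in>K. \<Sum>l\<in>L.
    2 * (p k - q l) * Re (?y k l * cnj (?c k l))
    - (q l + s * (p k - q l)) * (cmod (?y k l))\<^sup>2)"
    by (intro sum.cong refl) (simp only: algebra_simps)
  finally show ?thesis .
qed

text \<open>Completing the square, multiplied by \<open>D\<close>. For \<open>D = 0\<close> both
  sides are 0.\<close>

lemma quadratic_bound:
  fixes y c :: complex
  assumes "D \<ge> 0" "D = 0 \<Longrightarrow> a = 0"
  shows "2 * a * Re (y * cnj c) - D * (cmod y)\<^sup>2 \<le> (cmod c)\<^sup>2 * (a\<^sup>2 / D)"
proof (cases "D = 0")
  case False
  then have D: "D > 0" using assms by simp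
  have "0 \<le> (cmod (of_real D * y - of_real a * c))\<^sup>2" by simp
  also have "\<dots> = D\<^sup>2 * (cmod y)\<^sup>2 - 2 * a * D * Re (y * cnj c) + a\<^sup>2 * (cmod c)\<^sup>2"
    unfolding cmod_power2 by (simp add: power2_eq_square algebra_simps)
  finally have "D * (2 * a * Re (y * cnj c) - D * (cmod y)\<^sup>2) \<le> D * ((cmod c)\<^sup>2 * (a\<^sup>2 / D))"
    using D by (simp add: power2_eq_square algebra_simps)
  then show ?thesis using D by (simp only: mult_le_cancel_left_pos)
qed (use assms in auto)

lemma interpolation_zero:
  fixes p q s :: real
  assumes "0 < s" "s < 1" "0 \<le> p" "0 \<le> q"
  shows "0 \<le> q + s * (p - q)" "q + s * (p - q) = 0 \<longleftrightarrow> p = 0 \<and> q = 0"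
proof -
  have eq: "q + s * (p - q) = (1 - s) * q + s * p" by (simp add: algebra_simps)
  show "0 \<le> q + s * (p - q)" unfolding eq using assms by simp
  have "0 \<le> (1 - s) * q" "0 \<le> s * p" using assms by simp_all
  then show "q + s * (p - q) = 0 \<longleftrightarrow> p = 0 \<and> q = 0"
    unfolding eq using assms by (simp add: add_nonneg_eq_0_iff) auto
qed

lemma variational_le:
  assumes fin: "finite I"
    and v: "spectral I \<rho> K v p" "complete_basis I K v"
    and w: "spectral I \<sigma> L w q" "complete_basis I L w"
    and s: "0 < s" "s < 1"
  shows "variational I \<rho> \<sigma> s Y \<le> resolvent_sum I K v p L w q s"
  unfolding variational_spectral[OF fin v w] resolvent_sum_def
proof (intro sum_mono quadratic_bound)
  fix k l assume "k \<in> K" "l \<in> L"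
  then have "0 \<le> p k" "0 \<le> q l" using v(1) w(1) by (auto simp: spectral_def)
  note z = interpolation_zero[OF s this]
  show "0 \<le> q l + s * (p k - q l)" by (rule z(1))
  show "q l + s * (p k - q l) = 0 \<Longrightarrow> p k - q l = 0" by (simp only: z(2))
qed

lemma variational_attained:
  assumes fin: "finite I" "finite K" "finite L"
    and v: "spectral I \<rho> K v p" "complete_basis I K v"
    and w: "spectral I \<sigma> L w q" "complete_basis I L w"
    and s: "0 < s" "s < 1"
  shows "\<exists>Y. variational I \<rho> \<sigma> s Y = resolvent_sum I K v p L w q s"
proof -
  \<comment> \<open>The maximizer of each scalar quadratic, that is the equality case of
    \<open>quadratic_bound\<close>. \<open>Y\<close> is the operator with these mixed matrix
    entries.\<close>
  define g where "g k l = of_real ((p k - q l) / (q l + s * (p k - q l))) * ip I (v k) (w l)" for k l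
  define Y where "Y i j = (\<Sum>(k, l)\<in>K \<times> L. g k l * v k i * cnj (w l j))" for i j
  have Y: "form I Y (v k) (w l) = g k l" if k: "k \<in> K" and l: "l \<in> L" for k l
  proof -
    have "form I Y (v k) (w l) = (\<Sum>z\<in>K \<times> L. g (fst z) (snd z) * ip I (v k) (v (fst z)) * ip I (w (snd z)) (w l))"
      by (rule form_expand) (simp add: Y_def case_prod_beta)
    also have "\<dots> = (\<Sum>z\<in>K \<times> L. g (fst z) (snd z) * of_bool ((k, l) = z))"
      by (intro sum.cong refl) (auto simp: spectral_ip[OF v(1) k] spectral_ip[OF w(1) _ l])
    also have "\<dots> = g k l" using fin k l by (subst sum_of_bool_eq) auto
    finally show ?thesis .
  qed
  have "variational I \<rho> \<sigma> s Y = resolvent_sum I K v p L w q s"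
    unfolding variational_spectral[OF fin(1) v w] resolvent_sum_def
  proof (intro sum.cong refl)
    fix k l assume kl: "k \<in> K" "l \<in> L"
    define D where "D = q l + s * (p k - q l)"
    let ?c = "ip I (v k) (w l)"
    have "0 \<le> p k" "0 \<le> q l" using kl v(1) w(1) by (auto simp: spectral_def)
    note z = interpolation_zero[OF s this, folded D_def]
    have "g k l * cnj ?c = of_real ((p k - q l) / D * (cmod ?c)\<^sup>2)"
      unfolding g_def D_def[symmetric] mult.assoc complex_norm_square[symmetric] by simp
    then have 1: "Re (g k l * cnj ?c) = (p k - q l) / D * (cmod ?c)\<^sup>2"
      by (simp only: Re_complex_of_real)
    have 2: "(cmod (g k l))\<^sup>2 = ((p k - q l) / D)\<^sup>2 * (cmod ?c)\<^sup>2"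
      unfolding g_def D_def[symmetric] norm_mult norm_of_real by (simp add: power_mult_distrib power_divide)
    have "2 * (p k - q l) * Re (g k l * cnj ?c) - D * (cmod (g k l))\<^sup>2 = (cmod ?c)\<^sup>2 * ((p k - q l)\<^sup>2 / D)"
    proof (cases "D = 0")
      case False
      then show ?thesis unfolding 1 2 by (simp add: field_simps power2_eq_square)
    qed (use z(2) in simp)
    then show "2 * (p k - q l) * Re (form I Y (v k) (w l) * cnj ?c) -
        (q l + s * (p k - q l)) * (cmod (form I Y (v k) (w l)))\<^sup>2 =
        (cmod ?c)\<^sup>2 * ((p k - q l)\<^sup>2 / (q l + s * (p k - q l)))"
      unfolding Y[OF kl] D_def .
  qed
  then show ?thesis by (rule exI[of _ Y])
qed

section \<open>Monotonicity of relative entropy under the partial trace\<close>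

definition ptrace :: "'t set \<Rightarrow> ('i \<times> 't \<Rightarrow> 'i \<times> 't \<Rightarrow> complex) \<Rightarrow> 'i \<Rightarrow> 'i \<Rightarrow> complex" where
  "ptrace T \<rho> i j = (\<Sum>t\<in>T. \<rho> (i, t) (j, t))"

text \<open>The operator \<open>Y \<otimes> 1\<close>.\<close>

definition ampliate :: "('i \<Rightarrow> 'i \<Rightarrow> complex) \<Rightarrow> 'i \<times> 't \<Rightarrow> 'i \<times> 't \<Rightarrow> complex" where
  "ampliate Y x y = Y (fst x) (fst y) * of_bool (snd x = snd y)"

lemma sum_Times: "(\<Sum>z\<in>I \<times> T. f z) = (\<Sum>i\<in>I. \<Sum>t\<in>T. f (i, t))"
  by (simp add: sum.cartesian_product)

lemma cnj_of_bool [simp]: "cnj (of_bool b) = of_bool b"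
  by (cases b) simp_all

lemma tr_ampliate:
  assumes "finite T"
  shows "tr (I \<times> T) \<rho> (ampliate Y) = tr I (ptrace T \<rho>) Y"
proof -
  have "tr (I \<times> T) \<rho> (ampliate Y) =
      (\<Sum>i\<in>I. \<Sum>t\<in>T. \<Sum>j\<in>I. \<Sum>u\<in>T. \<rho> (i, t) (j, u) * Y j i * of_bool (u = t))"
    unfolding tr_def ampliate_def by (simp only: sum_Times fst_conv snd_conv mult.assoc)
  also have "\<dots> = (\<Sum>i\<in>I. \<Sum>t\<in>T. \<Sum>j\<in>I. \<rho> (i, t) (j, t) * Y j i)"
    using assms by (intro sum.cong refl sum_of_bool_eq)
  also have "\<dots> = (\<Sum>i\<in>I. \<Sum>j\<in>I. \<Sum>t\<in>T. \<rho> (i, t) (j, t) * Y j i)"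
    by (intro sum.cong refl sum.swap)
  finally show ?thesis unfolding tr_def ptrace_def by (simp add: sum_distrib_right)
qed

text \<open>Vectors supported on one slice \<open>u\<close> see only the diagonal block of the
  kernel there; these blocks add up to the partial trace.\<close>

lemma form_slice:
  assumes "finite T" "u \<in> T"
  shows "form (I \<times> T) \<rho> (\<lambda>z. x (fst z) * of_bool (snd z = u)) (\<lambda>z. y (fst z) * of_bool (snd z = u)) =
    form I (\<lambda>i j. \<rho> (i, u) (j, u)) x y"
proof -
  have "form (I \<times> T) \<rho> (\<lambda>z. x (fst z) * of_bool (snd z = u)) (\<lambda>z. y (fst z) * of_bool (snd z = u)) =
      (\<Sum>i\<in>I. \<Sum>t\<in>T. (\<Sum>j\<in>I. \<Sum>t'\<in>T. cnj (x i) * \<rho> (i, t) (j, t') * y j * of_bool (t' = u)) * of_bool (t = u))"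
    unfolding form_def
    by (simp add: sum_Times sum_distrib_left sum_distrib_right mult_ac)
  also have "\<dots> = (\<Sum>i\<in>I. \<Sum>j\<in>I. \<Sum>t'\<in>T. cnj (x i) * \<rho> (i, u) (j, t') * y j * of_bool (t' = u))"
    using assms by (intro sum.cong refl sum_of_bool_eq)
  also have "\<dots> = (\<Sum>i\<in>I. \<Sum>j\<in>I. cnj (x i) * \<rho> (i, u) (j, u) * y j)"
    using assms by (intro sum.cong refl sum_of_bool_eq)
  finally show ?thesis by (simp add: form_def)
qed

lemma form_ptrace: "form I (ptrace T \<rho>) x y = (\<Sum>u\<in>T. form I (\<lambda>i j. \<rho> (i, u) (j, u)) x y)"
proof -
  have "form I (ptrace T \<rho>) x y = (\<Sum>i\<in>I. \<Sum>u\<in>T. \<Sum>j\<in>I. cnj (x i) * \<rho> (i, u) (j, u) * y j)"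
    unfolding form_def ptrace_def by (subst sum.swap[of _ I T]) (simp add: sum_distrib_left sum_distrib_right)
  then show ?thesis unfolding form_def by (subst (asm) sum.swap)
qed

text \<open>Each column of \<open>Y \<otimes> 1\<close> is a column of \<open>Y\<close> placed in a
  single slice, so \<open>form_slice\<close> and \<open>form_ptrace\<close> apply.\<close>

lemma left_energy_ampliate:
  assumes "finite T"
  shows "left_energy (I \<times> T) \<rho> (ampliate Y) = left_energy I (ptrace T \<rho>) Y"
proof -
  have "left_energy (I \<times> T) \<rho> (ampliate Y) = (\<Sum>m\<in>I. \<Sum>u\<in>T.
      form (I \<times> T) \<rho> (\<lambda>z. Y (fst z) m * of_bool (snd z = u)) (\<lambda>z. Y (fst z) m * of_bool (snd z = u)))"
    unfolding left_energy_def ampliate_def by (simp only: sum_Times fst_conv snd_conv)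
  also have "\<dots> = left_energy I (ptrace T \<rho>) Y"
    unfolding left_energy_def form_ptrace using assms by (intro sum.cong refl form_slice)
  finally show ?thesis .
qed

lemma right_energy_ampliate:
  fixes T :: "'t set" and I :: "'i set"
  assumes "finite T"
  shows "right_energy (I \<times> T) \<rho> (ampliate Y) = right_energy I (ptrace T \<rho>) Y"
proof -
  have eq: "cnj (ampliate Y (m, u) z) = cnj (Y m (fst z)) * of_bool (snd z = u)"
    for m and u :: 't and z :: "'i \<times> 't"
    by (auto simp: ampliate_def)
  have "right_energy (I \<times> T) \<rho> (ampliate Y) = (\<Sum>m\<in>I. \<Sum>u\<in>T.
      form (I \<times> T) \<rho> (\<lambda>z. cnj (Y m (fst z)) * of_bool (snd z = u)) (\<lambda>z. cnj (Y m (fst z)) * of_bool (snd z = u)))"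
    unfolding right_energy_def by (simp only: sum_Times eq)
  also have "\<dots> = right_energy I (ptrace T \<rho>) Y"
    unfolding right_energy_def form_ptrace using assms by (intro sum.cong refl form_slice)
  finally show ?thesis .
qed

text \<open>The optimal operator for the marginals, ampliated, is a trial operator with the same
  value for the full kernels.\<close>

lemma resolvent_sum_ptrace:
  assumes fin: "finite I" "finite T" "finite K'" "finite L'"
    and v: "spectral (I \<times> T) \<rho> K v p" "complete_basis (I \<times> T) K v"
    and w: "spectral (I \<times> T) \<sigma> L w q" "complete_basis (I \<times> T) L w"
    and v': "spectral I (ptrace T \<rho>) K' v' p'" "complete_basis I K' v'"
    and w': "spectral I (ptrace T \<sigma>) L' w' q'" "complete_basis I L' w'"
    and s: "0 < s" "s < 1"
  shows "resolvent_sum I K' v' p' L' w' q' s \<le> resolvent_sum (I \<times> T) K v p L w q s"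
proof -
  obtain Y where "variational I (ptrace T \<rho>) (ptrace T \<sigma>) s Y = resolvent_sum I K' v' p' L' w' q' s"
    using variational_attained[OF fin(1,3,4) v' w' s] by blast
  moreover have "variational (I \<times> T) \<rho> \<sigma> s (ampliate Y) = variational I (ptrace T \<rho>) (ptrace T \<sigma>) s Y"
    using fin(2) by (simp add: variational_def tr_ampliate left_energy_ampliate right_energy_ampliate)
  moreover have "variational (I \<times> T) \<rho> \<sigma> s (ampliate Y) \<le> resolvent_sum (I \<times> T) K v p L w q s"
    using fin by (intro variational_le[OF _ v w s]) simp
  ultimately show ?thesis by simp
qed

section \<open>Integration over the interpolation parameter\<close>

definition rel_term :: "real \<Rightarrow> real \<Rightarrow> real" where
  "rel_term p q = p * ln p - p * ln q - p + q"

text \<open>\<open>rel_term p q\<close> is the first-order Taylor remainder of x ln x at q; its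
  integral form has the integrand of which this is an antiderivative in s. Comparing integrals
  becomes comparing endpoint values.\<close>

definition rel_prim :: "real \<Rightarrow> real \<Rightarrow> real \<Rightarrow> real" where
  "rel_prim p q s = p * ln (q + s * (p - q)) - s * (p - q)"

lemma rel_prim_deriv:
  assumes "0 \<le> p" "0 \<le> q" "q = 0 \<Longrightarrow> p = 0" "0 < s" "s < 1"
  shows "(rel_prim p q has_real_derivative (1 - s) * ((p - q)\<^sup>2 / (q + s * (p - q)))) (at s)"
proof (cases "q = 0")
  case True
  then show ?thesis using assms by (simp add: rel_prim_def[abs_def])
next
  case False
  let ?D = "q + s * (p - q)"
  have D: "?D > 0"
    using interpolation_zero[of s p q] assms False by linarith
  have "(rel_prim p q has_real_derivative p * ((p - q) / ?D) - (p - q)) (at s)"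
    unfolding rel_prim_def[abs_def] using D by (auto intro!: derivative_eq_intros)
  also have "p * ((p - q) / ?D) - (p - q) = (1 - s) * ((p - q)\<^sup>2 / ?D)"
    using D by (simp add: field_simps power2_eq_square)
  finally show ?thesis .
qed

text \<open>If \<open>p = 0\<close>, the logarithm has factor 0 even at s = 1, where its argument
  vanishes. Otherwise the support condition gives q > 0, and the argument stays positive up to both
  endpoints.\<close>

lemma rel_prim_continuous:
  assumes "0 \<le> p" "0 \<le> q" "q = 0 \<Longrightarrow> p = 0"
  shows "continuous_on {0..1} (rel_prim p q)"
proof (cases "p = 0")
  case True
  then show ?thesis by (simp add: rel_prim_def[abs_def] continuous_intros)
next
  case False
  then have pq: "p > 0" "q > 0" using assms by force+
  have "q + s * (p - q) \<noteq> 0" if "s \<in> {0..1}" for s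
  proof -
    have "q + s * (p - q) = (1 - s) * q + s * p" by (simp add: algebra_simps)
    moreover have "(1 - s) * q + s * p > 0"
    proof (cases "s = 0")
      case False
      then have "s * p > 0" "(1 - s) * q \<ge> 0" using that pq by auto
      then show ?thesis by linarith
    qed (use pq in simp)
    ultimately show ?thesis by simp
  qed
  then show ?thesis unfolding rel_prim_def[abs_def] by (intro continuous_intros) auto
qed

text \<open>Integrating over \<open>s\<close>: \<open>rel_term p q\<close> is the integral over \<open>0 < s < 1\<close> of
  \<open>(1 - s) (p - q)\<^sup>2 / (q + s (p - q))\<close>.\<close>

lemma rel_term_sum_le:
  fixes w :: "'a \<Rightarrow> real" and w' :: "'b \<Rightarrow> real"
  assumes pos: "\<And>a. a \<in> A \<Longrightarrow> 0 \<le> p a \<and> 0 \<le> q a \<and> (w a \<noteq> 0 \<longrightarrow> q a = 0 \<longrightarrow> p a = 0)"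
    and pos': "\<And>b. b \<in> B \<Longrightarrow> 0 \<le> p' b \<and> 0 \<le> q' b \<and> (w' b \<noteq> 0 \<longrightarrow> q' b = 0 \<longrightarrow> p' b = 0)"
    and le: "\<And>s. 0 < s \<Longrightarrow> s < 1 \<Longrightarrow>
      (\<Sum>a\<in>A. w a * ((p a - q a)\<^sup>2 / (q a + s * (p a - q a)))) \<le>
      (\<Sum>b\<in>B. w' b * ((p' b - q' b)\<^sup>2 / (q' b + s * (p' b - q' b))))"
  shows "(\<Sum>a\<in>A. w a * rel_term (p a) (q a)) \<le> (\<Sum>b\<in>B. w' b * rel_term (p' b) (q' b))"
proof -
  have deriv: "((\<lambda>s. w * rel_prim p q s) has_real_derivative
      (1 - s) * (w * ((p - q)\<^sup>2 / (q + s * (p - q))))) (at s)"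
    if "0 \<le> p \<and> 0 \<le> q \<and> (w \<noteq> 0 \<longrightarrow> q = 0 \<longrightarrow> p = 0)" "0 < s" "s < 1" for w p q s :: real
  proof (cases "w = 0")
    case False
    show ?thesis
      using DERIV_cmult[OF rel_prim_deriv[of p q s], of w] that False by (simp add: mult.left_commute)
  qed simp
  have cont: "continuous_on {0..1} (\<lambda>s. w * rel_prim p q s)"
    if "0 \<le> p \<and> 0 \<le> q \<and> (w \<noteq> 0 \<longrightarrow> q = 0 \<longrightarrow> p = 0)" for w p q :: real
    using that rel_prim_continuous[of p q] by (cases "w = 0") (auto intro: continuous_on_mult_left)
  \<comment> \<open>The difference of the two weighted antiderivatives. By \<open>le\<close> its
    derivative is nonnegative inside the interval, and its increment from 0 to 1 is the difference
    of the two sums in the claim.\<close>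
  let ?H = "\<lambda>s. (\<Sum>b\<in>B. w' b * rel_prim (p' b) (q' b) s) - (\<Sum>a\<in>A. w a * rel_prim (p a) (q a) s)"
  have "?H 0 \<le> ?H 1"
  proof (rule DERIV_nonneg_imp_increasing_open[of 0 1 ?H])
    show "continuous_on {0..1} ?H"
      using cont pos pos' by (intro continuous_on_diff continuous_on_sum) auto
    fix s :: real assume s: "0 < s" "s < 1"
    have "(?H has_real_derivative
        (\<Sum>b\<in>B. (1 - s) * (w' b * ((p' b - q' b)\<^sup>2 / (q' b + s * (p' b - q' b))))) -
        (\<Sum>a\<in>A. (1 - s) * (w a * ((p a - q a)\<^sup>2 / (q a + s * (p a - q a)))))) (at s)"
      using deriv pos pos' s by (intro DERIV_diff DERIV_sum) auto
    moreover have "0 \<le> (\<Sum>b\<in>B. (1 - s) * (w' b * ((p' b - q' b)\<^sup>2 / (q' b + s * (p' b - q' b))))) -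
        (\<Sum>a\<in>A. (1 - s) * (w a * ((p a - q a)\<^sup>2 / (q a + s * (p a - q a)))))"
      unfolding sum_distrib_left[symmetric] diff_ge_0_iff_ge
      by (rule mult_left_mono[OF le[OF s]]) (use s in simp)
    ultimately show "\<exists>y. (?H has_real_derivative y) (at s) \<and> 0 \<le> y" by blast
  qed simp
  moreover have rt: "rel_term p q = rel_prim p q 1 - rel_prim p q 0" for p q
    by (simp add: rel_prim_def rel_term_def)
  ultimately show ?thesis unfolding rt right_diff_distrib sum_subtractf by simp
qed

text \<open>Relative entropy with natural logarithms, plus the trace of the second kernel minus that
  of the first, written through the overlaps of the two eigenbases.\<close>

definition rel_entropy where
  "rel_entropy I K v p L w q =
     (\<Sum>k\<in>K. \<Sum>l\<in>L. (cmod (ip I (v k) (w l)))\<^sup>2 * rel_term (p k) (q l))"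

text \<open>The vanishing form is a sum of nonnegative terms, so \<open>x\<close> meets only
  eigenvectors with eigenvalue 0.\<close>

lemma overlap_support:
  assumes "finite K" "spectral I \<rho> K v p" "form I \<rho> x x = 0" "k \<in> K" "ip I (v k) x \<noteq> 0"
  shows "p k = 0"
proof -
  have p: "\<forall>k\<in>K. 0 \<le> p k" using assms(2) by (simp add: spectral_def)
  have "form I \<rho> x x = of_real (\<Sum>k\<in>K. p k * (cmod (ip I x (v k)))\<^sup>2)"
    unfolding form_spectral[OF assms(2)] mult.assoc ip_cmod by simp
  then have "(\<Sum>k\<in>K. p k * (cmod (ip I x (v k)))\<^sup>2) = 0"
    using assms(3) by (metis of_real_eq_0_iff)
  then have "p k * (cmod (ip I x (v k)))\<^sup>2 = 0"
    using assms(1,4) p by (subst (asm) sum_nonneg_eq_0_iff) auto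
  moreover have "ip I x (v k) \<noteq> 0" using assms(5) by (metis cnj_ip complex_cnj_zero_iff)
  ultimately show ?thesis by simp
qed

text \<open>The inequality for each s is integrated. The conditions \<open>supp\<close> and
  \<open>supp'\<close> express inclusion of supports; otherwise the convention
  \<open>ln 0 = 0\<close> would give a finite value where relative entropy is infinite.\<close>

theorem rel_entropy_ptrace_le:
  assumes fin: "finite I" "finite T" "finite K" "finite L" "finite K'" "finite L'"
    and v: "spectral (I \<times> T) \<rho> K v p" "complete_basis (I \<times> T) K v"
    and w: "spectral (I \<times> T) \<sigma> L w q" "complete_basis (I \<times> T) L w"
    and v': "spectral I (ptrace T \<rho>) K' v' p'" "complete_basis I K' v'"
    and w': "spectral I (ptrace T \<sigma>) L' w' q'" "complete_basis I L' w'"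
    and supp: "\<And>l. l \<in> L \<Longrightarrow> q l = 0 \<Longrightarrow> form (I \<times> T) \<rho> (w l) (w l) = 0"
    and supp': "\<And>l. l \<in> L' \<Longrightarrow> q' l = 0 \<Longrightarrow> form I (ptrace T \<rho>) (w' l) (w' l) = 0"
  shows "rel_entropy I K' v' p' L' w' q' \<le> rel_entropy (I \<times> T) K v p L w q"
  unfolding rel_entropy_def sum.cartesian_product case_prod_beta
proof (rule rel_term_sum_le)
  fix z assume z: "z \<in> K' \<times> L'"
  then show "0 \<le> p' (fst z) \<and> 0 \<le> q' (snd z) \<and> ((cmod (ip I (v' (fst z)) (w' (snd z))))\<^sup>2 \<noteq> 0 \<longrightarrow>
      q' (snd z) = 0 \<longrightarrow> p' (fst z) = 0)"
    using overlap_support[OF fin(5) v'(1) supp'] v'(1) w'(1) by (auto simp: spectral_def)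
next
  fix z assume z: "z \<in> K \<times> L"
  then show "0 \<le> p (fst z) \<and> 0 \<le> q (snd z) \<and> ((cmod (ip (I \<times> T) (v (fst z)) (w (snd z))))\<^sup>2 \<noteq> 0 \<longrightarrow>
      q (snd z) = 0 \<longrightarrow> p (fst z) = 0)"
    using overlap_support[OF fin(3) v(1) supp] v(1) w(1) by (auto simp: spectral_def)
next
  fix s :: real assume "0 < s" "s < 1"
  from resolvent_sum_ptrace[OF fin(1,2,5,6) v w v' w' this]
  show "(\<Sum>z\<in>K' \<times> L'. (cmod (ip I (v' (fst z)) (w' (snd z))))\<^sup>2 *
      ((p' (fst z) - q' (snd z))\<^sup>2 / (q' (snd z) + s * (p' (fst z) - q' (snd z))))) \<le>
    (\<Sum>z\<in>K \<times> L. (cmod (ip (I \<times> T) (v (fst z)) (w (snd z))))\<^sup>2 *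
      ((p (fst z) - q (snd z))\<^sup>2 / (q (snd z) + s * (p (fst z) - q (snd z)))))"
    unfolding resolvent_sum_def sum.cartesian_product case_prod_beta .
qed

text \<open>With both bases orthonormal and complete, the overlap matrix has row and column sums 1.
  The last sum is the trace of \<open>\<rho>\<close> times the logarithm of
  \<open>\<sigma>\<close>.\<close>

lemma rel_entropy_eq:
  assumes fin: "finite I" "finite K"
    and v: "spectral I \<rho> K v p" "complete_basis I K v"
    and w: "spectral I \<sigma> L w q" "complete_basis I L w"
  shows "rel_entropy I K v p L w q = (\<Sum>k\<in>K. p k * ln (p k)) - (\<Sum>k\<in>K. p k) + (\<Sum>l\<in>L. q l)
    - (\<Sum>l\<in>L. ln (q l) * Re (form I \<rho> (w l) (w l)))"
proof -
  let ?m = "\<lambda>k l. (cmod (ip I (v k) (w l)))\<^sup>2"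
  have row: "(\<Sum>l\<in>L. ?m k l) = 1" if "k \<in> K" for k
  proof -
    have "complex_of_real (\<Sum>l\<in>L. ?m k l) = ip I (v k) (v k)"
      by (subst parseval[OF fin(1) w(2)]) (simp only: ip_cmod of_real_sum)
    also have "\<dots> = of_real 1" using spectral_ip[OF v(1) that that] by simp
    finally show ?thesis by (simp only: of_real_eq_iff)
  qed
  have col: "(\<Sum>k\<in>K. ?m k l) = 1" if "l \<in> L" for l
  proof -
    have "complex_of_real (\<Sum>k\<in>K. ?m k l) = ip I (w l) (w l)"
      by (subst parseval[OF fin(1) v(2)]) (simp only: ip_cmod[symmetric] of_real_sum mult.commute)
    also have "\<dots> = of_real 1" using spectral_ip[OF w(1) that that] by simp
    finally show ?thesis by (simp only: of_real_eq_iff)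
  qed
  have diag: "Re (form I \<rho> (w l) (w l)) = (\<Sum>k\<in>K. p k * ?m k l)" for l
  proof -
    have "form I \<rho> (w l) (w l) = of_real (\<Sum>k\<in>K. p k * ?m k l)"
      unfolding form_spectral[OF v(1)] of_real_sum of_real_mult ip_cmod[symmetric] by (simp only: mult_ac)
    then show ?thesis by (simp only: Re_complex_of_real)
  qed
  have "rel_entropy I K v p L w q = (\<Sum>k\<in>K. \<Sum>l\<in>L. p k * ln (p k) * ?m k l - p k * ?m k l
      + ?m k l * q l - ln (q l) * (p k * ?m k l))"
    unfolding rel_entropy_def rel_term_def by (intro sum.cong refl) (simp only: algebra_simps)
  also have "\<dots> = (\<Sum>k\<in>K. p k * ln (p k) * (\<Sum>l\<in>L. ?m k l)) - (\<Sum>k\<in>K. p k * (\<Sum>l\<in>L. ?m k l))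
      + (\<Sum>k\<in>K. \<Sum>l\<in>L. ?m k l * q l) - (\<Sum>k\<in>K. \<Sum>l\<in>L. ln (q l) * (p k * ?m k l))"
    by (simp only: sum.distrib sum_subtractf sum_distrib_left)
  also have "(\<Sum>k\<in>K. \<Sum>l\<in>L. ?m k l * q l) = (\<Sum>l\<in>L. (\<Sum>k\<in>K. ?m k l) * q l)"
    by (subst sum.swap) (simp only: sum_distrib_right)
  also have "(\<Sum>k\<in>K. \<Sum>l\<in>L. ln (q l) * (p k * ?m k l)) = (\<Sum>l\<in>L. ln (q l) * Re (form I \<rho> (w l) (w l)))"
    unfolding diag by (subst sum.swap) (simp only: sum_distrib_left)
  finally show ?thesis by (simp add: row col)
qed

section \<open>Von Neumann entropy of marginals\<close>

lemma linear_factors_unique: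
  fixes as bs :: "'a :: idom list"
  assumes "(\<Prod>a\<leftarrow>as. [:- a, 1:]) = (\<Prod>b\<leftarrow>bs. [:- b, 1:])"
  shows "mset as = mset bs"
  using assms
proof (induction as arbitrary: bs)
  case Nil
  have "degree (\<Prod>b\<leftarrow>bs. [:- b, 1:]) = length bs" by (rule degree_linear_factors)
  then show ?case using Nil by simp
next
  case (Cons a as)
  have "poly (\<Prod>b\<leftarrow>bs. [:- b, 1:]) a = 0" unfolding Cons.prems[symmetric] by simp
  then have "a \<in> set bs" by (induction bs) auto
  then obtain bs1 bs2 where bs: "bs = bs1 @ a # bs2" by (meson split_list)
  have "[:- a, 1:] * (\<Prod>a\<leftarrow>as. [:- a, 1:]) = [:- a, 1:] * (\<Prod>b\<leftarrow>bs1 @ bs2. [:- b, 1:])"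
    using Cons.prems unfolding bs by (simp only: list.map map_append prod_list.Cons prod_list.append mult_ac)
  then have "(\<Prod>a\<leftarrow>as. [:- a, 1:]) = (\<Prod>b\<leftarrow>bs1 @ bs2. [:- b, 1:])"
    by (simp only: mult_cancel_left) simp
  then have "mset as = mset (bs1 @ bs2)" by (rule Cons.IH)
  then show ?case by (simp add: bs)
qed

lemma sum_mat_mult:
  "i < dim_row M \<Longrightarrow> j < dim_col N \<Longrightarrow> dim_col M = dim_row N \<Longrightarrow>
    (M * N) $$ (i, j) = (\<Sum>k<dim_row N. M $$ (i, k) * N $$ (k, j))"
  by (simp add: scalar_prod_def lessThan_atLeast0)

text \<open>Similarity gives the characteristic polynomial of the diagonal matrix. Whatever list
  \<open>eigvals\<close> chooses has the diagonal as its multiset, on which alone the entropy sum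
  depends.\<close>

lemma vn_entropy_diagonal:
  assumes U: "U \<in> carrier_mat n n" "mat_adjoint U * U = 1\<^sub>m n"
    and A: "A = U * mat n n (\<lambda>(i, j). if i = j then d i else 0) * mat_adjoint U"
  shows "vn_entropy A = - (\<Sum>k<n. Re (d k) * log 2 (Re (d k)))"
proof -
  let ?D = "mat n n (\<lambda>(i, j). if i = j then d i else 0)"
  have U': "mat_adjoint U \<in> carrier_mat n n" using U(1) by simp
  have UU': "U * mat_adjoint U = 1\<^sub>m n" by (rule mat_mult_left_right_inverse[OF U' U])
  have Ac: "A \<in> carrier_mat n n" unfolding A using U(1) U' by auto
  have "similar_mat A ?D"
    by (rule similar_matI[of _ _ U "mat_adjoint U" n]) (use U U' UU' Ac A in auto)
  then have cp: "char_poly A = (\<Prod>a\<leftarrow>map d [0..<n]. [:- a, 1:])"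
    by (subst char_poly_similar, assumption, subst char_poly_upper_triangular[of _ n])
      (auto simp: diag_mat_def intro!: arg_cong[of _ _ prod_list])
  have "dim_row A = n" using Ac by simp
  have "char_poly A = (\<Prod>a\<leftarrow>eigvals A. [:- a, 1:]) \<and> length (eigvals A) = dim_row A"
    unfolding eigvals_def by (rule someI_ex) (unfold \<open>dim_row A = n\<close>, rule char_poly_factorized[OF Ac])
  then have ms: "mset (eigvals A) = mset (map d [0..<n])"
    by (intro linear_factors_unique) (simp only: cp)
  let ?f = "\<lambda>l. Re l * log 2 (Re l)"
  have "sum_list (map ?f xs) = sum_mset (image_mset ?f (mset xs))" for xs
    unfolding mset_map[symmetric] sum_mset_sum_list ..
  then have "(\<Sum>l\<leftarrow>eigvals A. ?f l) = (\<Sum>l\<leftarrow>map d [0..<n]. ?f l)"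
    by (simp only: ms)
  also have "\<dots> = (\<Sum>k<n. Re (d k) * log 2 (Re (d k)))"
    by (simp add: comp_def interv_sum_list_conv_sum_set_nat lessThan_atLeast0)
  finally show ?thesis by (simp add: vn_entropy_def)
qed

lemma form_dm: "form I (dm T amp) x y = (\<Sum>t\<in>T. ip I x (\<lambda>i. amp i t) * ip I (\<lambda>i. amp i t) y)"
proof -
  have "form I (dm T amp) x y = (\<Sum>t\<in>T. 1 * ip I x (\<lambda>i. amp i t) * ip I (\<lambda>i. amp i t) y)"
    by (rule form_expand) (simp add: dm_def)
  then show ?thesis by simp
qed

lemma form_dm_self: "form I (dm T amp) x x = of_real (\<Sum>t\<in>T. (cmod (ip I x (\<lambda>i. amp i t)))\<^sup>2)"
  unfolding form_dm ip_cmod by simp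

lemma reduced_dm_spectral:
  assumes T: "finite T" and dec: "bij_betw dec {..<n} I"
  obtains v p where "spectral I (dm T amp) I v p" "complete_basis I I v"
    "vn_entropy (reduced_dm n dec T amp) = - (\<Sum>k\<in>I. p k * log 2 (p k))"
proof -
  let ?A = "reduced_dm n dec T amp"
  have A: "?A \<in> carrier_mat n n" by (simp add: reduced_dm_def)
  have "mat_adjoint ?A = ?A"
    by (intro eq_matI) (auto simp: reduced_dm_def mult.commute)
  then obtain U d where U: "U \<in> carrier_mat n n" "mat_adjoint U * U = 1\<^sub>m n"
    and AU: "?A = U * mat n n (\<lambda>(i, j). if i = j then d i else 0) * mat_adjoint U"
    using hermitian_diagonalization[OF A] by blast
  have U': "mat_adjoint U \<in> carrier_mat n n" using U(1) by simp
  have UU': "U * mat_adjoint U = 1\<^sub>m n" by (rule mat_mult_left_right_inverse[OF U' U])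
  \<comment> \<open>The inverse enumeration labels both matrix positions and eigenvectors by
    elements of \<open>I\<close>.\<close>
  define e where "e = inv_into {..<n} dec"
  have e: "bij_betw e I {..<n}" unfolding e_def by (rule bij_betw_inv_into[OF dec])
  have e_less: "e i < n" if "i \<in> I" for i using e that by (auto simp: bij_betw_def)
  have dec_e: "dec (e i) = i" if "i \<in> I" for i
    unfolding e_def using dec that by (simp add: bij_betw_inv_into_right)
  have e_eq: "e i = e j \<longleftrightarrow> i = j" if "i \<in> I" "j \<in> I" for i j
    using dec_e that by metis
  have finI: "finite I" using dec by (metis bij_betw_finite finite_lessThan)
  define v where "v k i = U $$ (e i, e k)" for k i
  have re: "(\<Sum>i\<in>I. f (e i)) = (\<Sum>i<n. f i)" for f :: "nat \<Rightarrow> complex"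
    by (rule sum.reindex_bij_betw[OF e])
  have orth: "orthonormal I I v"
    unfolding orthonormal_def
  proof (intro ballI)
    fix k l assume kl: "k \<in> I" "l \<in> I"
    have "ip I (v k) (v l) = (\<Sum>i<n. cnj (U $$ (i, e k)) * U $$ (i, e l))"
      unfolding ip_def v_def by (rule re)
    also have "\<dots> = (mat_adjoint U * U) $$ (e k, e l)"
      using U(1) kl e_less by (subst sum_mat_mult) auto
    finally show "ip I (v k) (v l) = of_bool (k = l)"
      using kl e_less e_eq by (simp add: U(2))
  qed
  have comp: "complete_basis I I v"
    unfolding complete_basis_def
  proof (intro ballI)
    fix i j assume ij: "i \<in> I" "j \<in> I"
    have "(\<Sum>k\<in>I. v k i * cnj (v k j)) = (\<Sum>k<n. U $$ (e i, k) * cnj (U $$ (e j, k)))"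
      unfolding v_def by (rule re)
    also have "\<dots> = (U * mat_adjoint U) $$ (e i, e j)"
      using U(1) ij e_less by (subst sum_mat_mult) auto
    finally show "(\<Sum>k\<in>I. v k i * cnj (v k j)) = of_bool (i = j)"
      using ij e_less e_eq by (simp add: UU')
  qed
  have kernel: "dm T amp i j = (\<Sum>k\<in>I. d (e k) * v k i * cnj (v k j))" if ij: "i \<in> I" "j \<in> I" for i j
  proof -
    have UD: "(U * mat n n (\<lambda>(i, j). if i = j then d i else 0)) $$ (i, k) = d k * U $$ (i, k)"
      if "i < n" "k < n" for i k
      using U(1) that by (subst sum_mat_mult) (simp_all add: if_distrib[of "\<lambda>x. _ * x"] mult.commute cong: if_cong)
    have "dm T amp i j = ?A $$ (e i, e j)"
      using ij e_less dec_e by (simp add: reduced_dm_def dm_def)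
    also have "\<dots> = (\<Sum>k<n. (U * mat n n (\<lambda>(i, j). if i = j then d i else 0)) $$ (e i, k) *
        mat_adjoint U $$ (k, e j))"
      unfolding AU using U(1) ij e_less by (subst sum_mat_mult) auto
    also have "\<dots> = (\<Sum>k<n. d k * U $$ (e i, k) * cnj (U $$ (e j, k)))"
      by (rule sum.cong[OF refl], subst UD) (use U(1) ij e_less in auto)
    also have "\<dots> = (\<Sum>k\<in>I. d (e k) * v k i * cnj (v k j))"
      unfolding v_def by (rule re[symmetric])
    finally show ?thesis .
  qed
  \<comment> \<open>Each eigenvalue is the value of the form on its eigenvector, a sum of squared
    moduli; hence it is real and nonnegative.\<close>
  have d: "d (e k) = of_real (Re (d (e k)))" "0 \<le> Re (d (e k))" if k: "k \<in> I" for k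
  proof -
    have "form I (dm T amp) (v k) (v k) = (\<Sum>l\<in>I. d (e l) * ip I (v k) (v l) * ip I (v l) (v k))"
      by (rule form_expand) (rule kernel)
    also have "\<dots> = (\<Sum>l\<in>I. d (e l) * of_bool (k = l))"
      by (intro sum.cong refl) (simp add: orthonormalD[OF orth] k)
    also have "\<dots> = d (e k)" using finI k by (simp only: sum_of_bool_eq)
    finally have dk: "d (e k) = of_real (\<Sum>t\<in>T. (cmod (ip I (v k) (\<lambda>i. amp i t)))\<^sup>2)"
      unfolding form_dm_self by (rule sym)
    show "d (e k) = of_real (Re (d (e k)))" unfolding dk Re_complex_of_real ..
    show "0 \<le> Re (d (e k))" unfolding dk Re_complex_of_real by (intro sum_nonneg) simp
  qed
  have "spectral I (dm T amp) I v (\<lambda>k. Re (d (e k)))"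
    unfolding spectral_def
  proof (intro conjI ballI)
    fix i j assume ij: "i \<in> I" "j \<in> I"
    show "dm T amp i j = (\<Sum>k\<in>I. of_real (Re (d (e k))) * v k i * cnj (v k j))"
      unfolding kernel[OF ij] by (intro sum.cong refl) (simp only: d(1)[symmetric])
  qed (use orth d(2) in auto)
  moreover have "vn_entropy ?A = - (\<Sum>k\<in>I. Re (d (e k)) * log 2 (Re (d (e k))))"
    unfolding vn_entropy_diagonal[OF U AU]
    by (subst sum.reindex_bij_betw[OF e, symmetric]) simp
  ultimately show thesis using comp that by blast
qed

text \<open>Von Neumann entropy of the marginal on \<open>I\<close>, chosen through any
  decomposition to avoid an enumeration; \<open>entropy_spectral\<close> shows that all
  decompositions agree.\<close>

definition entropy :: "'i set \<Rightarrow> 't set \<Rightarrow> ('i \<Rightarrow> 't \<Rightarrow> complex) \<Rightarrow> real" where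
  "entropy I T amp =
     (SOME s. \<exists>v p. spectral I (dm T amp) I v p \<and> s = - (\<Sum>k\<in>I. p k * log 2 (p k)))"

lemma dm_spectral:
  assumes "finite I" "finite T"
  obtains v p where "spectral I (dm T amp) I v p" "complete_basis I I v"
proof -
  obtain dec :: "nat \<Rightarrow> 'a" where "bij_betw dec {0..<card I} I"
    using ex_bij_betw_nat_finite[OF assms(1)] by blast
  then show ?thesis using reduced_dm_spectral[OF assms(2), of dec "card I" I amp] that
    by (auto simp: lessThan_atLeast0)
qed

lemma entropy_spectral:
  assumes fin: "finite I" "finite T" "finite K" and v: "spectral I (dm T amp) K v p"
  shows "entropy I T amp = - (\<Sum>k\<in>K. p k * log 2 (p k))"
proof -
  obtain v0 p0 where "spectral I (dm T amp) I v0 p0" by (rule dm_spectral[OF fin(1,2)])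
  then have "\<exists>s v p. spectral I (dm T amp) I v p \<and> s = - (\<Sum>k\<in>I. p k * log 2 (p k))" by blast
  then have "\<exists>v p. spectral I (dm T amp) I v p \<and> entropy I T amp = - (\<Sum>k\<in>I. p k * log 2 (p k))"
    unfolding entropy_def by (rule someI_ex)
  then obtain v1 p1 where v1: "spectral I (dm T amp) I v1 p1"
    and "entropy I T amp = - (\<Sum>k\<in>I. p1 k * log 2 (p1 k))"
    by blast
  then show ?thesis
    using spectral_sum_unique[OF fin(1,3) v1 v, of "\<lambda>x. x * log 2 x"] by simp
qed

lemma vn_entropy_reduced_dm:
  assumes "finite T" "bij_betw dec {..<n} I"
  shows "vn_entropy (reduced_dm n dec T amp) = entropy I T amp"
proof -
  have fin: "finite I" using assms(2) by (metis bij_betw_finite finite_lessThan)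
  obtain v p where "spectral I (dm T amp) I v p"
    "vn_entropy (reduced_dm n dec T amp) = - (\<Sum>k\<in>I. p k * log 2 (p k))"
    by (rule reduced_dm_spectral[OF assms])
  then show ?thesis using entropy_spectral[OF fin assms(1) fin] by simp
qed

text \<open>Complementary marginals of a pure state share their nonzero eigenvalues, and zero
  eigenvalues contribute nothing.\<close>

lemma entropy_swap:
  assumes fin: "finite I" "finite T"
  shows "entropy T I (\<lambda>t i. amp i t) = entropy I T amp"
proof -
  obtain v p where v: "spectral I (dm T amp) I v p" "complete_basis I I v"
    by (rule dm_spectral[OF fin])
  have "entropy T I (\<lambda>t i. amp i t) = - (\<Sum>k\<in>{k \<in> I. p k > 0}. p k * log 2 (p k))"
    by (rule entropy_spectral[OF fin(2,1) _ spectral_complement[OF fin fin(1) v]]) (use fin in simp)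
  also have "(\<Sum>k\<in>{k \<in> I. p k > 0}. p k * log 2 (p k)) = (\<Sum>k\<in>I. p k * log 2 (p k))"
  proof (rule sum.mono_neutral_left)
    have "p k = 0" if "k \<in> I" "\<not> p k > 0" for k
      using v(1) that by (force simp: spectral_def)
    then show "\<forall>k\<in>I - {k \<in> I. p k > 0}. p k * log 2 (p k) = 0" by auto
  qed (use fin in auto)
  finally show ?thesis using entropy_spectral[OF fin fin(1) v(1)] by simp
qed

text \<open>Used to reorder and regroup tensor factors. The relabelled eigenvectors keep their index
  set \<open>I'\<close>, which \<open>entropy_spectral\<close> permits.\<close>

lemma entropy_reindex:
  assumes g: "bij_betw g I I'" and h: "bij_betw h T T'" and fin: "finite I" "finite T"
    and eq: "\<And>i t. i \<in> I \<Longrightarrow> t \<in> T \<Longrightarrow> amp i t = amp' (g i) (h t)"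
  shows "entropy I T amp = entropy I' T' amp'"
proof -
  have fin': "finite I'" "finite T'" using g h fin by (metis bij_betw_finite)+
  obtain v p where v: "spectral I' (dm T' amp') I' v p" by (rule dm_spectral[OF fin'])
  have dm: "dm T amp i j = dm T' amp' (g i) (g j)" if "i \<in> I" "j \<in> I" for i j
  proof -
    have "dm T' amp' (g i) (g j) = (\<Sum>t\<in>T. amp' (g i) (h t) * cnj (amp' (g j) (h t)))"
      unfolding dm_def by (rule sum.reindex_bij_betw[OF h, symmetric])
    then show ?thesis using that by (simp add: dm_def eq)
  qed
  have gI: "g i \<in> I'" if "i \<in> I" for i using g that by (auto simp: bij_betw_def)
  have "ip I (\<lambda>i. x (g i)) (\<lambda>i. y (g i)) = ip I' x y" for x y
    unfolding ip_def by (rule sum.reindex_bij_betw[OF g])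
  then have "spectral I (dm T amp) I' (\<lambda>k i. v k (g i)) p"
    using v gI dm unfolding spectral_def orthonormal_def by auto
  then show ?thesis
    using entropy_spectral[OF fin fin'(1)] entropy_spectral[OF fin' fin'(1) v] by simp
qed

section \<open>Strong subadditivity\<close>

text \<open>All marginals of one amplitude thus have the same trace, its squared norm; this cancels
  the linear terms of the relative entropies.\<close>

lemma trace_spectral:
  assumes "spectral I (dm T amp) K v p"
  shows "(\<Sum>k\<in>K. p k) = (\<Sum>i\<in>I. \<Sum>t\<in>T. (cmod (amp i t))\<^sup>2)"
proof -
  have "complex_of_real (\<Sum>k\<in>K. p k) = (\<Sum>k\<in>K. of_real (p k) * ip I (v k) (v k))"
    by (simp add: spectral_ip[OF assms])
  also have "\<dots> = (\<Sum>k\<in>K. \<Sum>i\<in>I. of_real (p k) * v k i * cnj (v k i))"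
    by (simp add: ip_def sum_distrib_left mult_ac)
  also have "\<dots> = (\<Sum>i\<in>I. \<Sum>k\<in>K. of_real (p k) * v k i * cnj (v k i))"
    by (rule sum.swap)
  also have "\<dots> = (\<Sum>i\<in>I. dm T amp i i)"
    using assms by (intro sum.cong refl) (simp add: spectral_def)
  also have "\<dots> = of_real (\<Sum>i\<in>I. \<Sum>t\<in>T. (cmod (amp i t))\<^sup>2)"
    unfolding dm_def of_real_sum complex_norm_square ..
  finally show ?thesis using of_real_eq_iff by blast
qed

lemma sum_split:
  assumes "bij_betw (\<lambda>i. (f i, g i)) I (A \<times> J)"
  shows "(\<Sum>i\<in>I. F (f i) (g i)) = (\<Sum>a\<in>A. \<Sum>j\<in>J. F a j)"
  using sum.reindex_bij_betw[OF assms, of "\<lambda>z. F (fst z) (snd z)"] by (simp add: sum_Times)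

text \<open>The eigenvectors of \<open>1 \<otimes> \<rho>\<close> are products of a basis vector of
  \<open>A\<close> with some \<open>w l\<close>. Coordinates \<open>f\<close>, \<open>g\<close>
  stand in for a literal product since the triple system is bracketed the other way.\<close>

lemma spectral_identity_tensor:
  assumes bij: "bij_betw (\<lambda>i. (f i, g i)) I (A \<times> J)" and fin: "finite A"
    and w: "spectral J \<rho> L w q" "complete_basis J L w"
  shows "spectral I (\<lambda>i j. of_bool (f i = f j) * \<rho> (g i) (g j)) (A \<times> L)
      (\<lambda>z i. of_bool (fst z = f i) * w (snd z) (g i)) (\<lambda>z. q (snd z))" (is "spectral I ?\<sigma> _ ?w _")
    and "complete_basis I (A \<times> L) (\<lambda>z i. of_bool (fst z = f i) * w (snd z) (g i))"
proof -
  have fA: "f i \<in> A" "g i \<in> J" if "i \<in> I" for i using bij that by (auto simp: bij_betw_def)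
  have inj: "i = j \<longleftrightarrow> f i = f j \<and> g i = g j" if "i \<in> I" "j \<in> I" for i j
    using bij that by (auto simp: bij_betw_def inj_on_def)
  have expand: "(\<Sum>z\<in>A \<times> L. c (snd z) * ?w z i * cnj (?w z j)) =
      of_bool (f i = f j) * (\<Sum>l\<in>L. c l * w l (g i) * cnj (w l (g j)))" if i: "i \<in> I" for c i j
  proof -
    have "(\<Sum>z\<in>A \<times> L. c (snd z) * ?w z i * cnj (?w z j)) =
        (\<Sum>a\<in>A. of_bool (a = f i) * (of_bool (a = f j) * (\<Sum>l\<in>L. c l * w l (g i) * cnj (w l (g j)))))"
      by (simp add: sum_Times sum_distrib_left mult_ac)
    also have "\<dots> = of_bool (f i = f j) * (\<Sum>l\<in>L. c l * w l (g i) * cnj (w l (g j)))"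
      using fA(1)[OF i] fin by (subst sum_of_bool_eq) auto
    finally show ?thesis .
  qed
  show "complete_basis I (A \<times> L) ?w"
    unfolding complete_basis_def
  proof (intro ballI)
    fix i j assume ij: "i \<in> I" "j \<in> I"
    have "(\<Sum>z\<in>A \<times> L. ?w z i * cnj (?w z j)) = of_bool (f i = f j) * (\<Sum>l\<in>L. w l (g i) * cnj (w l (g j)))"
      using expand[OF ij(1), of "\<lambda>_. 1" j] by simp
    also have "(\<Sum>l\<in>L. w l (g i) * cnj (w l (g j))) = of_bool (g i = g j)"
      using w(2) fA ij by (simp add: complete_basis_def)
    finally show "(\<Sum>z\<in>A \<times> L. ?w z i * cnj (?w z j)) = of_bool (i = j)"
      using inj[OF ij] by simp
  qed
  have "ip I (?w z) (?w z') = of_bool (z = z')" if z: "z \<in> A \<times> L" and z': "z' \<in> A \<times> L" for z z'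
  proof -
    have "ip I (?w z) (?w z') = (\<Sum>a\<in>A. \<Sum>j\<in>J.
        cnj (of_bool (fst z = a) * w (snd z) j) * (of_bool (fst z' = a) * w (snd z') j))"
      unfolding ip_def by (rule sum_split[OF bij])
    also have "\<dots> = (\<Sum>a\<in>A. of_bool (fst z = a) * (of_bool (fst z' = a) * ip J (w (snd z)) (w (snd z'))))"
      unfolding ip_def by (simp add: sum_distrib_left mult_ac)
    also have "\<dots> = of_bool (fst z' = fst z) * ip J (w (snd z)) (w (snd z'))"
      using fin z by (subst sum_of_bool_eq) auto
    also have "ip J (w (snd z)) (w (snd z')) = of_bool (snd z = snd z')"
      using z z' by (intro spectral_ip[OF w(1)]) auto
    finally show ?thesis by (auto simp: prod_eq_iff)
  qed
  moreover have "?\<sigma> i j = (\<Sum>z\<in>A \<times> L. of_real (q (snd z)) * ?w z i * cnj (?w z j))"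
    if ij: "i \<in> I" "j \<in> I" for i j
  proof -
    have "\<rho> (g i) (g j) = (\<Sum>l\<in>L. of_real (q l) * w l (g i) * cnj (w l (g j)))"
      using w(1) fA ij by (simp add: spectral_def)
    then show ?thesis using expand[OF ij(1), of "\<lambda>l. of_real (q l)" j] by simp
  qed
  ultimately show "spectral I ?\<sigma> (A \<times> L) ?w (\<lambda>z. q (snd z))"
    using w(1) unfolding spectral_def orthonormal_def by auto
qed

text \<open>\<open>f\<close> and \<open>g\<close> are the coordinates of \<open>I\<close> as a product \<open>A \<times> J\<close>; the second state is the
  marginal on \<open>J\<close>, tensored with the identity on \<open>A\<close>.\<close>

lemma form_identity_tensor:
  assumes bij: "bij_betw (\<lambda>i. (f i, g i)) I (A \<times> J)" and fin: "finite A" "finite L"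
    and amp: "\<And>i t. amp i t = amp' (g i) (f i, t)"
    and w: "spectral J (dm (A \<times> T) amp') L w q" and l: "l \<in> L"
  shows "(\<Sum>a\<in>A. Re (form I (dm T amp) (\<lambda>i. of_bool (a = f i) * w l (g i))
      (\<lambda>i. of_bool (a = f i) * w l (g i)))) = q l"
proof -
  \<comment> \<open>The basis vector of \<open>A\<close> selects the slice of \<open>amp'\<close>
    with \<open>a\<close> on the traced-out side.\<close>
  have ip: "ip I (\<lambda>i. of_bool (a = f i) * w l (g i)) (\<lambda>i. amp i t) = ip J (w l) (\<lambda>j. amp' j (a, t))"
    if "a \<in> A" for a t
  proof -
    have "ip I (\<lambda>i. of_bool (a = f i) * w l (g i)) (\<lambda>i. amp i t) =
        (\<Sum>b\<in>A. \<Sum>j\<in>J. cnj (of_bool (a = b) * w l j) * amp' j (b, t))"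
      unfolding ip_def amp by (rule sum_split[OF bij])
    also have "\<dots> = (\<Sum>b\<in>A. of_bool (a = b) * ip J (w l) (\<lambda>j. amp' j (b, t)))"
      unfolding ip_def by (simp add: sum_distrib_left mult_ac)
    also have "\<dots> = ip J (w l) (\<lambda>j. amp' j (a, t))"
      using fin that by (simp only: sum_of_bool_eq)
    finally show ?thesis .
  qed
  have "(\<Sum>a\<in>A. Re (form I (dm T amp) (\<lambda>i. of_bool (a = f i) * w l (g i)) (\<lambda>i. of_bool (a = f i) * w l (g i)))) =
      (\<Sum>a\<in>A. \<Sum>t\<in>T. (cmod (ip J (w l) (\<lambda>j. amp' j (a, t))))\<^sup>2)"
    unfolding form_dm_self Re_complex_of_real by (intro sum.cong refl) (simp only: ip)
  also have "\<dots> = Re (form J (dm (A \<times> T) amp') (w l) (w l))"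
    unfolding form_dm_self Re_complex_of_real sum_Times ..
  also have "\<dots> = q l"
    using form_eigen_left[OF fin(2) w l, of "w l"] spectral_ip[OF w l l] by simp
  finally show ?thesis .
qed

text \<open>The cross term of \<open>\<rho>\<close> with \<open>1 \<otimes> \<rho>\<^sub>J\<close>
  reduces to the marginal on \<open>J\<close>, leaving a difference of entropies. The factor
  \<open>card A\<close> is the trace of the identity on \<open>A\<close>. The second claim supplies
  the support condition.\<close>

lemma rel_entropy_identity_tensor:
  assumes bij: "bij_betw (\<lambda>i. (f i, g i)) I (A \<times> J)"
    and fin: "finite I" "finite A" "finite K" "finite L"
    and amp: "\<And>i t. amp i t = amp' (g i) (f i, t)"
    and v: "spectral I (dm T amp) K v p" "complete_basis I K v"
    and w: "spectral J (dm (A \<times> T) amp') L w q" "complete_basis J L w"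
  shows "rel_entropy I K v p (A \<times> L) (\<lambda>z i. of_bool (fst z = f i) * w (snd z) (g i)) (\<lambda>z. q (snd z)) =
      (\<Sum>k\<in>K. p k * ln (p k)) - (\<Sum>l\<in>L. q l * ln (q l)) + (real (card A) - 1) * (\<Sum>k\<in>K. p k)"
    (is "rel_entropy I K v p _ ?w _ = _")
    and "z \<in> A \<times> L \<Longrightarrow> q (snd z) = 0 \<Longrightarrow> form I (dm T amp)
      (\<lambda>i. of_bool (fst z = f i) * w (snd z) (g i)) (\<lambda>i. of_bool (fst z = f i) * w (snd z) (g i)) = 0"
proof -
  note \<sigma> = spectral_identity_tensor[OF bij fin(2) w]
  note diag = form_identity_tensor[OF bij fin(2,4) amp w(1)]
  have "(\<Sum>l\<in>L. q l) = (\<Sum>j\<in>J. \<Sum>t\<in>A \<times> T. (cmod (amp' j t))\<^sup>2)" by (rule trace_spectral[OF w(1)])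
  also have "\<dots> = (\<Sum>a\<in>A. \<Sum>j\<in>J. \<Sum>t\<in>T. (cmod (amp' j (a, t)))\<^sup>2)"
    unfolding sum_Times by (rule sum.swap)
  also have "\<dots> = (\<Sum>i\<in>I. \<Sum>t\<in>T. (cmod (amp i t))\<^sup>2)"
    unfolding amp by (rule sum_split[OF bij, symmetric])
  also have "\<dots> = (\<Sum>k\<in>K. p k)" by (rule trace_spectral[OF v(1), symmetric])
  finally have tr: "(\<Sum>l\<in>L. q l) = (\<Sum>k\<in>K. p k)" .
  have "(\<Sum>z\<in>A \<times> L. ln (q (snd z)) * Re (form I (dm T amp) (?w z) (?w z))) =
      (\<Sum>l\<in>L. ln (q l) * (\<Sum>a\<in>A. Re (form I (dm T amp) (?w (a, l)) (?w (a, l)))))"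
    unfolding sum_Times by (subst sum.swap) (simp add: sum_distrib_left)
  also have "\<dots> = (\<Sum>l\<in>L. q l * ln (q l))"
    by (intro sum.cong refl) (simp add: diag)
  finally have cross: "(\<Sum>z\<in>A \<times> L. ln (q (snd z)) * Re (form I (dm T amp) (?w z) (?w z))) =
      (\<Sum>l\<in>L. q l * ln (q l))" .
  have "(\<Sum>z\<in>A \<times> L. q (snd z)) = real (card A) * (\<Sum>k\<in>K. p k)"
    by (simp add: sum_Times tr)
  then show "rel_entropy I K v p (A \<times> L) ?w (\<lambda>z. q (snd z)) =
      (\<Sum>k\<in>K. p k * ln (p k)) - (\<Sum>l\<in>L. q l * ln (q l)) + (real (card A) - 1) * (\<Sum>k\<in>K. p k)"
    unfolding rel_entropy_eq[OF fin(1,3) v \<sigma>] cross by (simp add: algebra_simps)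
  assume z: "z \<in> A \<times> L" and q0: "q (snd z) = 0"
  \<comment> \<open>The nonnegative values over all \<open>a\<close> sum to the eigenvalue 0, so
    each of them vanishes.\<close>
  have "(\<Sum>a\<in>A. Re (form I (dm T amp) (?w (a, snd z)) (?w (a, snd z)))) = 0"
    using diag[of "snd z"] z q0 by auto
  then have "Re (form I (dm T amp) (?w (fst z, snd z)) (?w (fst z, snd z))) = 0"
    using z fin(2) by (subst (asm) sum_nonneg_eq_0_iff) (auto simp: form_dm_self intro!: sum_nonneg simp del: of_real_sum)
  then show "form I (dm T amp) (?w z) (?w z) = 0"
    unfolding form_dm_self Re_complex_of_real by simp
qed

text \<open>Tracing out \<open>C\<close> keeps the identity on \<open>A\<close> and sends the
  marginal on \<open>B \<times> C\<close> to that on \<open>B\<close>. Both relative entropies carry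
  the same factor \<open>card A\<close>, so the trace terms cancel and only entropies
  remain.\<close>

theorem strong_subadditivity:
  fixes amp :: "('a \<times> 'b) \<times> 'c \<Rightarrow> 't \<Rightarrow> complex"
  assumes fin: "finite A" "finite B" "finite C" "finite T"
  shows "entropy ((A \<times> B) \<times> C) T amp + entropy B (A \<times> C \<times> T) (\<lambda>b (a, c, t). amp ((a, b), c) t)
    \<le> entropy (A \<times> B) (C \<times> T) (\<lambda>ab (c, t). amp (ab, c) t)
      + entropy (B \<times> C) (A \<times> T) (\<lambda>(b, c) (a, t). amp ((a, b), c) t)"
proof -
  define amp1 where "amp1 = (\<lambda>(b, c) (a, t). amp ((a, b), c) t)"
  define amp2 where "amp2 = (\<lambda>ab (c, t). amp (ab, c) t)"
  define amp3 where "amp3 = (\<lambda>b (a, c, t). amp ((a, b), c) t)"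
  obtain v p where v: "spectral ((A \<times> B) \<times> C) (dm T amp) ((A \<times> B) \<times> C) v p"
    "complete_basis ((A \<times> B) \<times> C) ((A \<times> B) \<times> C) v"
    using dm_spectral[of "(A \<times> B) \<times> C" T amp] fin by auto
  obtain w q where w: "spectral (B \<times> C) (dm (A \<times> T) amp1) (B \<times> C) w q" "complete_basis (B \<times> C) (B \<times> C) w"
    using dm_spectral[of "B \<times> C" "A \<times> T" amp1] fin by auto
  obtain v' p' where v': "spectral (A \<times> B) (dm (C \<times> T) amp2) (A \<times> B) v' p'" "complete_basis (A \<times> B) (A \<times> B) v'"
    using dm_spectral[of "A \<times> B" "C \<times> T" amp2] fin by auto
  obtain w' q' where w': "spectral B (dm (A \<times> C \<times> T) amp3) B w' q'" "complete_basis B B w'"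
    using dm_spectral[of B "A \<times> C \<times> T" amp3] fin by auto
  let ?f = "\<lambda>i :: ('a \<times> 'b) \<times> 'c. fst (fst i)" and ?g = "\<lambda>i :: ('a \<times> 'b) \<times> 'c. (snd (fst i), snd i)"
  have bij: "bij_betw (\<lambda>i. (?f i, ?g i)) ((A \<times> B) \<times> C) (A \<times> (B \<times> C))"
    by (rule bij_betwI[where g = "\<lambda>(a, b, c). ((a, b), c)"]) auto
  have bij': "bij_betw (\<lambda>i. (fst i, snd i)) (A \<times> B) (A \<times> B)"
    by (rule bij_betwI[where g = "\<lambda>z. z"]) auto
  have amp1: "amp i t = amp1 (?g i) (?f i, t)" for i t by (simp add: amp1_def)
  have amp3: "amp2 i t = amp3 (snd i) (fst i, t)" for i t by (simp add: amp2_def amp3_def case_prod_beta)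
  note \<sigma> = spectral_identity_tensor[OF bij fin(1) w]
  note \<sigma>' = spectral_identity_tensor[OF bij' fin(1) w']
  have pt: "ptrace C (dm T amp) = dm (C \<times> T) amp2"
    by (intro ext) (simp add: ptrace_def dm_def amp2_def sum_Times)
  have pt': "ptrace C (\<lambda>i j. of_bool (?f i = ?f j) * dm (A \<times> T) amp1 (?g i) (?g j)) =
      (\<lambda>i j. of_bool (fst i = fst j) * dm (A \<times> C \<times> T) amp3 (snd i) (snd j))"
    by (intro ext) (simp add: ptrace_def dm_def amp1_def amp3_def sum_Times sum_distrib_left[symmetric] sum.swap[of _ C A])
  have finI: "finite (A \<times> B)" "finite ((A \<times> B) \<times> C)" "finite (A \<times> B \<times> C)" "finite (B \<times> C)"
    using fin by auto
  note r = rel_entropy_identity_tensor[OF bij finI(2) fin(1) finI(2,4) amp1 v w]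
  note r' = rel_entropy_identity_tensor[OF bij' finI(1) fin(1) finI(1) fin(2) amp3 v' w']
  have "rel_entropy (A \<times> B) (A \<times> B) v' p' (A \<times> B) (\<lambda>z i. of_bool (fst z = fst i) * w' (snd z) (snd i)) (\<lambda>z. q' (snd z))
      \<le> rel_entropy ((A \<times> B) \<times> C) ((A \<times> B) \<times> C) v p (A \<times> (B \<times> C))
        (\<lambda>z i. of_bool (fst z = ?f i) * w (snd z) (?g i)) (\<lambda>z. q (snd z))"
    by (rule rel_entropy_ptrace_le[OF finI(1) fin(3) finI(2,3,1,1) v \<sigma>, unfolded pt pt', OF v' \<sigma>' r(2) r'(2)])
  then have "(\<Sum>k\<in>A \<times> B. p' k * ln (p' k)) - (\<Sum>l\<in>B. q' l * ln (q' l)) + (real (card A) - 1) * (\<Sum>k\<in>A \<times> B. p' k)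
      \<le> (\<Sum>k\<in>(A \<times> B) \<times> C. p k * ln (p k)) - (\<Sum>l\<in>B \<times> C. q l * ln (q l)) + (real (card A) - 1) * (\<Sum>k\<in>(A \<times> B) \<times> C. p k)"
    unfolding r(1) r'(1) .
  moreover have "(\<Sum>k\<in>A \<times> B. p' k) = (\<Sum>k\<in>(A \<times> B) \<times> C. p k)"
    unfolding trace_spectral[OF v(1)] trace_spectral[OF v'(1)] by (simp add: sum_Times amp2_def)
  ultimately have main: "(\<Sum>k\<in>A \<times> B. p' k * ln (p' k)) - (\<Sum>l\<in>B. q' l * ln (q' l))
      \<le> (\<Sum>k\<in>(A \<times> B) \<times> C. p k * ln (p k)) - (\<Sum>l\<in>B \<times> C. q l * ln (q l))" by simp
  \<comment> \<open>The base changes from e to 2 by the positive factor 1 / ln 2.\<close>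
  have log: "(\<Sum>k\<in>K. p k * log 2 (p k)) = (\<Sum>k\<in>K. p k * ln (p k)) / ln 2" for K and p :: "'k \<Rightarrow> real"
    by (simp add: log_def sum_divide_distrib)
  have "(\<Sum>k\<in>A \<times> B. p' k * log 2 (p' k)) - (\<Sum>l\<in>B. q' l * log 2 (q' l))
      \<le> (\<Sum>k\<in>(A \<times> B) \<times> C. p k * log 2 (p k)) - (\<Sum>l\<in>B \<times> C. q l * log 2 (q l))"
    unfolding log diff_divide_distrib[symmetric] by (rule divide_right_mono[OF main]) simp
  then show ?thesis
    unfolding amp1_def[symmetric] amp2_def[symmetric] amp3_def[symmetric]
    using entropy_spectral[OF _ _ _ v(1)] entropy_spectral[OF _ _ _ w(1)]
      entropy_spectral[OF _ _ _ v'(1)] entropy_spectral[OF _ _ _ w'(1)] fin by simp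
qed

section \<open>Superadditivity of coherent information\<close>

lemma bij_betw_div_mod:
  fixes m n :: nat
  shows "bij_betw (\<lambda>k. (k div n, k mod n)) {..<m * n} ({..<m} \<times> {..<n})"
proof (rule bij_betwI[where g = "\<lambda>(i, j). i * n + j"])
  show "(\<lambda>k. (k div n, k mod n)) \<in> {..<m * n} \<rightarrow> {..<m} \<times> {..<n}"
    by (auto simp: less_mult_imp_div_less intro!: mod_less_divisor gr0I)
  show "(\<lambda>(i, j). i * n + j) \<in> {..<m} \<times> {..<n} \<rightarrow> {..<m * n}"
  proof clarsimp
    fix i j assume "i < m" "j < n"
    then have "i * n + j < Suc i * n" by simp
    also have "\<dots> \<le> m * n" using \<open>i < m\<close> by (intro mult_le_mono1) simp
    finally show "i * n + j < m * n" .
  qed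
qed auto

lemma coherent_information_superadditive:
  fixes dR d1 e1 d2 e2 :: nat
  shows "Ic_B dR d1 e1 d2 e2 \<Psi> \<phi>1 \<phi>2 U1 U2 + Ic_C dR d1 e1 d2 e2 \<Psi> \<phi>1 \<phi>2 U1 U2
    \<le> Ic_BC dR d1 e1 d2 e2 \<Psi> \<phi>1 \<phi>2 U1 U2"
proof -
  \<comment> \<open>Here A and B stand for the systems of Bob and Charlie, X and Y for their
    environments.\<close>
  let ?R = "{..<dR}" and ?A = "{..<d1}" and ?X = "{..<e1}" and ?B = "{..<d2}" and ?Y = "{..<e2}"
  define \<psi> where "\<psi> = final_amp d1 e1 d2 e2 \<Psi> \<phi>1 \<phi>2 U1 U2"
  define sA where "sA = entropy ?A (?R \<times> ?X \<times> ?B \<times> ?Y) (\<lambda>a (r, x, b, y). \<psi> r a x b y)"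
  define sB where "sB = entropy ?B (?R \<times> ?A \<times> ?X \<times> ?Y) (\<lambda>b (r, a, x, y). \<psi> r a x b y)"
  define sRA where "sRA = entropy (?R \<times> ?A) (?X \<times> ?B \<times> ?Y) (\<lambda>(r, a) (x, b, y). \<psi> r a x b y)"
  define sRB where "sRB = entropy (?R \<times> ?B) (?A \<times> ?X \<times> ?Y) (\<lambda>(r, b) (a, x, y). \<psi> r a x b y)"
  define sAB where "sAB = entropy (?A \<times> ?B) (?R \<times> ?X \<times> ?Y) (\<lambda>(a, b) (r, x, y). \<psi> r a x b y)"
  define sRAB where "sRAB = entropy (?R \<times> ?A \<times> ?B) (?X \<times> ?Y) (\<lambda>(r, a, b) (x, y). \<psi> r a x b y)"
  have B: "Ic_B dR d1 e1 d2 e2 \<Psi> \<phi>1 \<phi>2 U1 U2 = sA - sRA"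
    unfolding Ic_B_def rho_Q1_def rho_RQ1_def sA_def sRA_def \<psi>_def
    by (intro arg_cong2[of _ _ _ _ "(-)"] vn_entropy_reduced_dm bij_betw_div_mod) (auto simp: bij_betw_def)
  have C: "Ic_C dR d1 e1 d2 e2 \<Psi> \<phi>1 \<phi>2 U1 U2 = sB - sRB"
    unfolding Ic_C_def rho_Q2_def rho_RQ2_def sB_def sRB_def \<psi>_def
    by (intro arg_cong2[of _ _ _ _ "(-)"] vn_entropy_reduced_dm bij_betw_div_mod) (auto simp: bij_betw_def)
  \<comment> \<open>The three mixed-radix digits come from two successive divisions with
    remainder.\<close>
  have bij3: "bij_betw (\<lambda>k. (k div (d1 * d2), (k div d2) mod d1, k mod d2)) {..<dR * d1 * d2} (?R \<times> ?A \<times> ?B)"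
  proof -
    have "bij_betw (\<lambda>((r, a), b). (r, a, b)) ((?R \<times> ?A) \<times> ?B) (?R \<times> ?A \<times> ?B)"
      by (rule bij_betwI[where g = "\<lambda>(r, a, b). ((r, a), b)"]) auto
    moreover have "bij_betw (\<lambda>(k, b). ((k div d1, k mod d1), b)) ({..<dR * d1} \<times> ?B) ((?R \<times> ?A) \<times> ?B)"
      using bij_betw_map_prod[OF bij_betw_div_mod[of d1 dR] bij_betw_id[of ?B]]
      by (simp add: map_prod_def)
    ultimately have "bij_betw ((\<lambda>((r, a), b). (r, a, b)) \<circ> (\<lambda>(k, b). ((k div d1, k mod d1), b)) \<circ> (\<lambda>k. (k div d2, k mod d2)))
        {..<dR * d1 * d2} (?R \<times> ?A \<times> ?B)"
      by (intro bij_betw_trans[OF bij_betw_div_mod] bij_betw_trans[of _ "{..<dR * d1} \<times> ?B"])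
    then show ?thesis by (simp add: comp_def div_mult2_eq mult.commute[of d1 d2])
  qed
  have BC: "Ic_BC dR d1 e1 d2 e2 \<Psi> \<phi>1 \<phi>2 U1 U2 = sAB - sRAB"
    unfolding Ic_BC_def rho_Q1Q2_def rho_RQ1Q2_def sAB_def sRAB_def \<psi>_def
    by (intro arg_cong2[of _ _ _ _ "(-)"] vn_entropy_reduced_dm bij_betw_div_mod bij3) auto
  \<comment> \<open>With Charlie's system in the middle, strong subadditivity bounds his coherent
    information by the joint one.\<close>
  have "entropy ((?R \<times> ?B) \<times> ?A) (?X \<times> ?Y) (\<lambda>((r, b), a) (x, y). \<psi> r a x b y) = sRAB"
    unfolding sRAB_def
    by (rule entropy_reindex[where g = "\<lambda>((r, b), a). (r, a, b)" and h = "\<lambda>z. z"])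
      (auto intro: bij_betwI[where g = "\<lambda>(r, a, b). ((r, b), a)"] bij_betwI[where g = "\<lambda>z. z"])
  moreover have "entropy (?B \<times> ?A) (?R \<times> ?X \<times> ?Y) (\<lambda>(b, a) (r, x, y). \<psi> r a x b y) = sAB"
    unfolding sAB_def
    by (rule entropy_reindex[where g = "\<lambda>(b, a). (a, b)" and h = "\<lambda>z. z"])
      (auto intro: bij_betwI[where g = "\<lambda>(a, b). (b, a)"] bij_betwI[where g = "\<lambda>z. z"])
  ultimately have ssa_B: "sRAB + sB \<le> sRB + sAB"
    using strong_subadditivity[of ?R ?B ?A "?X \<times> ?Y" "\<lambda>((r, b), a) (x, y). \<psi> r a x b y"]
    by (simp add: sB_def sRB_def case_prod_unfold)
  \<comment> \<open>The same with Bob's system in the middle.\<close>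
  have "entropy ((?R \<times> ?A) \<times> ?B) (?X \<times> ?Y) (\<lambda>((r, a), b) (x, y). \<psi> r a x b y) = sRAB"
    unfolding sRAB_def
    by (rule entropy_reindex[where g = "\<lambda>((r, a), b). (r, a, b)" and h = "\<lambda>z. z"])
      (auto intro: bij_betwI[where g = "\<lambda>(r, a, b). ((r, a), b)"] bij_betwI[where g = "\<lambda>z. z"])
  moreover have "entropy ?A (?R \<times> ?B \<times> ?X \<times> ?Y) (\<lambda>a (r, b, x, y). \<psi> r a x b y) = sA"
    unfolding sA_def
    by (rule entropy_reindex[where g = "\<lambda>z. z" and h = "\<lambda>(r, b, x, y). (r, x, b, y)"])
      (auto intro: bij_betwI[where g = "\<lambda>(r, x, b, y). (r, b, x, y)"] bij_betwI[where g = "\<lambda>z. z"])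
  moreover have "entropy (?R \<times> ?A) (?B \<times> ?X \<times> ?Y) (\<lambda>(r, a) (b, x, y). \<psi> r a x b y) = sRA"
    unfolding sRA_def
    by (rule entropy_reindex[where g = "\<lambda>z. z" and h = "\<lambda>(b, x, y). (x, b, y)"])
      (auto intro: bij_betwI[where g = "\<lambda>(x, b, y). (b, x, y)"] bij_betwI[where g = "\<lambda>z. z"])
  ultimately have ssa_A: "sRAB + sA \<le> sRA + sAB"
    using strong_subadditivity[of ?R ?A ?B "?X \<times> ?Y" "\<lambda>((r, a), b) (x, y). \<psi> r a x b y"]
    by (simp add: sAB_def case_prod_unfold)
  \<comment> \<open>Now both environments form the third system and Charlie's is traced out. Purity
    turns the entropies of R A X Y and A X Y into those of B and R B, so the two coherent
    informations sum to at most 0.\<close>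
  have "entropy ((?R \<times> ?A) \<times> ?X \<times> ?Y) ?B (\<lambda>((r, a), x, y) b. \<psi> r a x b y) = sB"
    unfolding sB_def
    by (subst entropy_swap[symmetric], simp, simp, rule entropy_reindex[where g = "\<lambda>z. z" and h = "\<lambda>((r, a), x, y). (r, a, x, y)"])
      (auto intro: bij_betwI[where g = "\<lambda>(r, a, x, y). ((r, a), x, y)"] bij_betwI[where g = "\<lambda>z. z"])
  moreover have "entropy (?A \<times> ?X \<times> ?Y) (?R \<times> ?B) (\<lambda>(a, x, y) (r, b). \<psi> r a x b y) = sRB"
    unfolding sRB_def
    by (subst entropy_swap[symmetric], simp, simp, rule entropy_reindex[where g = "\<lambda>z. z" and h = "\<lambda>z. z"])
      (auto intro: bij_betwI[where g = "\<lambda>z. z"])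
  moreover have "entropy ?A (?R \<times> (?X \<times> ?Y) \<times> ?B) (\<lambda>a (r, (x, y), b). \<psi> r a x b y) = sA"
    unfolding sA_def
    by (rule entropy_reindex[where g = "\<lambda>z. z" and h = "\<lambda>(r, (x, y), b). (r, x, b, y)"])
      (auto intro: bij_betwI[where g = "\<lambda>(r, x, b, y). (r, (x, y), b)"] bij_betwI[where g = "\<lambda>z. z"])
  moreover have "entropy (?R \<times> ?A) ((?X \<times> ?Y) \<times> ?B) (\<lambda>(r, a) ((x, y), b). \<psi> r a x b y) = sRA"
    unfolding sRA_def
    by (rule entropy_reindex[where g = "\<lambda>z. z" and h = "\<lambda>((x, y), b). (x, b, y)"])
      (auto intro: bij_betwI[where g = "\<lambda>(x, b, y). ((x, y), b)"] bij_betwI[where g = "\<lambda>z. z"])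
  ultimately have weak_mono: "sB + sA \<le> sRA + sRB"
    using strong_subadditivity[of ?R ?A "?X \<times> ?Y" ?B "\<lambda>((r, a), x, y) b. \<psi> r a x b y"]
    by (simp add: case_prod_unfold)
  \<comment> \<open>The sum of the three inequalities is twice the claim.\<close>
  show ?thesis unfolding B C BC using ssa_A ssa_B weak_mono by linarith
qed

theorem theorem2:
  fixes dR d1 e1 d2 e2 :: nat
    and \<Psi> :: "nat \<Rightarrow> nat \<Rightarrow> nat \<Rightarrow> complex"
    and \<phi>1 \<phi>2 :: "nat \<Rightarrow> complex"
    and U1 U2 :: "nat \<times> nat \<Rightarrow> nat \<times> nat \<Rightarrow> complex"
    and H_Bob H_Charlie chi_Q1 chi_E1 chi_Q2 chi_E2 P_ABC :: real
  assumes dims: "0 < dR" "0 < d1" "0 < e1" "0 < d2" "0 < e2"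
    and pure_Psi: "(\<Sum>r<dR. \<Sum>a<d1. \<Sum>b<d2. (cmod (\<Psi> r a b))\<^sup>2) = 1"
    and pure_E1: "(\<Sum>x<e1. (cmod (\<phi>1 x))\<^sup>2) = 1"
    and pure_E2: "(\<Sum>y<e2. (cmod (\<phi>2 y))\<^sup>2) = 1"
    and U1_unitary: "unitary_on ({..<d1} \<times> {..<e1}) U1"
    and U2_unitary: "unitary_on ({..<d2} \<times> {..<e2}) U2"
    and conv_B: "chi_Q1 - chi_E1 = Ic_B dR d1 e1 d2 e2 \<Psi> \<phi>1 \<phi>2 U1 U2"
    and conv_C: "chi_Q2 - chi_E2 = Ic_C dR d1 e1 d2 e2 \<Psi> \<phi>1 \<phi>2 U1 U2"
    and H_Bob_le: "H_Bob \<le> chi_Q1"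
    and H_Charlie_le: "H_Charlie \<le> chi_Q2"
    and SW_bound: "Ic_BC dR d1 e1 d2 e2 \<Psi> \<phi>1 \<phi>2 U1 U2 \<le> P_ABC"
  shows "(H_Bob - chi_E1) + (H_Charlie - chi_E2) \<le> P_ABC"
  \<comment> \<open>The Holevo bounds on \<open>H_Bob\<close> and \<open>H_Charlie\<close> bound
    each summand by a coherent information.\<close>
  using coherent_information_superadditive[of dR d1 e1 d2 e2 \<Psi> \<phi>1 \<phi>2 U1 U2]
    conv_B conv_C H_Bob_le H_Charlie_le SW_bound by linarith

end
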